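(* For every $\varepsilon>0$ there exists a transcendental entire function $f:\mathbb{C}\to\mathbb{C}$ such that $$\dim_{\mathrm{H}} K(f)\leq \dim_{\mathrm{P}} K(f)<\varepsilon,$$ where $K(f)=\{z\in\mathbb{C}: \text{the sequence } (f^n(z))_{n\in\mathbb{N}} \text{ is bounded}\}$.
   Context: A transcendental entire function is a function holomorphic on all of $\mathbb{C}$ that is not a polynomial. For an entire function $f$, $f^n$ denotes the $n$-th iterate of $f$ (the $n$-fold composition of $f$ with itself). For a subset $A\subset\mathbb{C}$, $\dim_{\mathrm{H}} A$ denotes the Hausdorff dimension of $A$ and $\dim_{\mathrm{P}} A$ denotes the packing dimension of $A$ (both with respect to the Euclidean metric on $\mathbb{C}$). *)

theory Defs
  imports "HOL-Complex_Analysis.Complex_Analysis"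
begin

section \<open>Hausdorff measure and dimension\<close>

text \<open>
  The case distinction implements the usual conventions for exponent \<open>0\<close>: a nonempty set contributes
  \<open>1\<close>, even if it is a single point (whereas \<open>0 powr 0 = 0\<close>), and the empty set contributes \<open>0\<close>.
\<close>

definition diam_powr :: "real \<Rightarrow> 'a::metric_space set \<Rightarrow> ennreal" where
  "diam_powr s U = (if U = {} then 0 else if s = 0 then 1 else ennreal (diameter U powr s))"

text \<open>
  Boundedness is required because \<open>diameter\<close> is real-valued and hence meaningless on
  unbounded sets. Finite covers are included, since members of the sequence may be empty.
\<close>

definition delta_cover :: "real \<Rightarrow> 'a::metric_space set \<Rightarrow> (nat \<Rightarrow> 'a set) \<Rightarrow> bool" where
  "delta_cover \<delta> A U \<longleftrightarrow> A \<subseteq> (\<Union>i. U i) \<and> (\<forall>i. bounded (U i) \<and> diameter (U i) \<le> \<delta>)"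

definition hausdorff_content :: "real \<Rightarrow> real \<Rightarrow> 'a::metric_space set \<Rightarrow> ennreal" where
  "hausdorff_content s \<delta> A = (INF U\<in>{U. delta_cover \<delta> A U}. \<Sum>i. diam_powr s (U i))"

text \<open>The content increases as \<open>\<delta>\<close> decreases, so the supremum is the limit for \<open>\<delta> \<rightarrow> 0\<close>.\<close>

definition hausdorff_measure :: "real \<Rightarrow> 'a::metric_space set \<Rightarrow> ennreal" where
  "hausdorff_measure s A = (SUP \<delta>\<in>{0<..}. hausdorff_content s \<delta> A)"

definition hausdorff_dim :: "'a::metric_space set \<Rightarrow> ennreal" where
  "hausdorff_dim A = Inf {ennreal s |s. s \<ge> 0 \<and> hausdorff_measure s A = 0}"

section \<open>Packing measure and dimension\<close>

text \<open>
  A packing is a countable family of pairwise disjoint closed balls centred in \<open>A\<close>, encoded by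
  the pairs of centre and radius. In the sum below, \<open>2 * r\<close> is the diameter of the ball; this
  agrees with the actual diameter in Euclidean spaces.
\<close>

definition delta_packing :: "real \<Rightarrow> 'a::metric_space set \<Rightarrow> ('a \<times> real) set \<Rightarrow> bool" where
  "delta_packing \<delta> A C \<longleftrightarrow> countable C \<and> (\<forall>(x, r)\<in>C. x \<in> A \<and> 0 < r \<and> r \<le> \<delta>) \<and>
     disjoint_family_on (\<lambda>(x, r). cball x r) C"

definition packing_content :: "real \<Rightarrow> real \<Rightarrow> 'a::metric_space set \<Rightarrow> ennreal" where
  "packing_content s \<delta> A =
     (SUP C\<in>{C. delta_packing \<delta> A C}. \<Sum>\<^sub>\<infinity>(x, r)\<in>C. ennreal ((2 * r) powr s))"

definition packing_premeasure :: "real \<Rightarrow> 'a::metric_space set \<Rightarrow> ennreal" where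
  "packing_premeasure s A = (INF \<delta>\<in>{0<..}. packing_content s \<delta> A)"

text \<open>The premeasure is only finitely subadditive, hence the passage to countable covers.\<close>

definition packing_measure :: "real \<Rightarrow> 'a::metric_space set \<Rightarrow> ennreal" where
  "packing_measure s A =
     (INF B\<in>{B :: nat \<Rightarrow> 'a set. A \<subseteq> (\<Union>i. B i)}. \<Sum>i. packing_premeasure s (B i))"

definition packing_dim :: "'a::metric_space set \<Rightarrow> ennreal" where
  "packing_dim A = Inf {ennreal s |s. s \<ge> 0 \<and> packing_measure s A = 0}"

section \<open>Iteration of transcendental entire functions\<close>

definition transcendental_entire :: "(complex \<Rightarrow> complex) \<Rightarrow> bool" where
  "transcendental_entire f \<longleftrightarrow> f holomorphic_on UNIV \<and> (\<nexists>p. f = poly p)"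

definition bounded_orbit_set :: "(complex \<Rightarrow> complex) \<Rightarrow> complex set" where
  "bounded_orbit_set f = {z. bounded (range (\<lambda>n. (f ^^ n) z))}"

end

theory Submission
  imports Defs
begin

text \<open>
  The function is \<open>f z = (\<Sum>n. c n * z ^ (n + 1))\<close> with very rapidly increasing quotients
  \<open>a n = c n / c (n + 1)\<close>. Around the circle of radius \<open>a n\<close> two terms dominate the series. The
  annuli \<open>2 * a n < norm z < a (n + 1) / 2 ^ 15\<close> are mapped into one another and hence escape.
  So a point \<open>z\<close> with bounded orbit satisfies \<open>norm z \<le> 2 * a n\<close> and
  \<open>norm (f z) \<le> 2 * a (n + 1)\<close> for its level \<open>n\<close>, and this keeps it away from the critical
  points: \<open>f\<close> expands distances by at least \<open>V ^ (n + 1)\<close> on each of at most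
  \<open>(2 ^ 42) ^ (n + 1)\<close> small squares that cover the points of level \<open>n\<close>, where \<open>V\<close> is as large as
  we like. Given \<open>s > 0\<close>, a suitable \<open>V\<close> makes the sum of (expansion factor)\<open> powr - s\<close> over
  all squares at most \<open>1 / 2\<close>, and this bounds the packing dimension by \<open>s\<close>.
\<close>

section \<open>Comparison of Hausdorff and packing dimension\<close>

text \<open>Multiplication by a positive finite constant is invertible on \<open>ennreal\<close>, so
  \<open>c\<close> can be divided out before the infimum is taken.\<close>

lemma le_ennreal_mult_INF:
  fixes c :: real and h :: ennreal
  assumes c: "c > 0" and le: "\<And>x. x \<in> I \<Longrightarrow> h \<le> ennreal c * g x"
  shows "h \<le> ennreal c * (INF x\<in>I. g x)"
proof -
  have cancel: "ennreal (1 / c) * (ennreal c * x) = x" "ennreal c * (ennreal (1 / c) * x) = x" for x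
    using c by (simp_all add: mult.assoc[symmetric] flip: ennreal_mult)
  have "ennreal (1 / c) * h \<le> g x" if "x \<in> I" for x
    using mult_left_mono[OF le[OF that], of "ennreal (1 / c)"] by (simp add: cancel)
  then have "ennreal (1 / c) * h \<le> (INF x\<in>I. g x)" by (rule INF_greatest)
  from mult_left_mono[OF this, of "ennreal c"] show ?thesis by (simp add: cancel)
qed

lemma hausdorff_content_antimono:
  assumes "\<delta> \<le> \<delta>'"
  shows "hausdorff_content s \<delta>' A \<le> hausdorff_content s \<delta> A"
  unfolding hausdorff_content_def delta_cover_def
  by (rule INF_superset_mono) (use assms in \<open>auto intro: order_trans\<close>)

lemma packing_content_mono:
  assumes "\<delta> \<le> \<delta>'"
  shows "packing_content s \<delta> A \<le> packing_content s \<delta>' A"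
  unfolding packing_content_def delta_packing_def
  by (rule SUP_subset_mono) (use assms in \<open>auto intro: order_trans\<close>)

text \<open>Take a packing of \<open>A\<close> by as many balls of radius \<open>r\<close> as
  possible. No further ball fits, so doubling the radii yields a cover of \<open>A\<close> by sets
  of diameter at most \<open>4 * r\<close>, twice the diameter \<open>2 * r\<close> that the packing
  sum uses; hence the factor \<open>2 powr s\<close>.\<close>

lemma hausdorff_content_le_packing_content:
  fixes A :: "'a::metric_space set"
  assumes s: "s \<ge> 0" and r: "r > 0"
  shows "hausdorff_content s (4 * r) A \<le> ennreal (2 powr s) * packing_content s r A"
proof (cases "packing_content s r A = top")
  case True
  then show ?thesis using s by (simp add: ennreal_mult_top)
next
  case False
  define Q where "Q S \<longleftrightarrow> finite S \<and> S \<subseteq> A \<and> disjoint_family_on (\<lambda>x. cball x r) S" for S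
  have le: "ennreal (real (card S) * (2 * r) powr s) \<le> packing_content s r A" if "Q S" for S
  proof -
    have "delta_packing r A ((\<lambda>x. (x, r)) ` S)"
      using that r unfolding delta_packing_def Q_def
      by (auto simp: disjoint_family_on_def countable_finite)
    then have "(\<Sum>\<^sub>\<infinity>(x, r)\<in>(\<lambda>x. (x, r)) ` S. ennreal ((2 * r) powr s)) \<le> packing_content s r A"
      unfolding packing_content_def by (intro SUP_upper) simp
    also have "(\<Sum>\<^sub>\<infinity>(x, r)\<in>(\<lambda>x. (x, r)) ` S. ennreal ((2 * r) powr s)) =
        (\<Sum>(x, r)\<in>(\<lambda>x. (x, r)) ` S. ennreal ((2 * r) powr s))"
      using that by (intro infsum_finite) (auto simp: Q_def)
    also have "\<dots> = (\<Sum>x\<in>S. ennreal ((2 * r) powr s))"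
      by (subst sum.reindex) (auto simp: inj_on_def)
    also have "\<dots> = ennreal (real (card S) * (2 * r) powr s)"
      using r by (simp add: ennreal_mult ennreal_of_nat_eq_real_of_nat)
    finally show ?thesis .
  qed
  \<comment> \<open>For equal radii the packing sum is a multiple of the number of balls. A finite
    content therefore bounds this number, and a packing of maximal cardinality exists.\<close>
  define c where "c = enn2real (packing_content s r A) / (2 * r) powr s"
  have pos: "(2 * r) powr s > 0" using r by simp
  have "real (card S) \<le> c" if "Q S" for S
  proof -
    have "real (card S) * (2 * r) powr s \<le> enn2real (packing_content s r A)"
      using le[OF that] False by (metis ennreal_enn2real_if ennreal_le_iff enn2real_nonneg)
    then show ?thesis using pos by (simp add: c_def field_simps)
  qed
  then have "\<forall>S. Q S \<longrightarrow> card S < Suc (nat \<lceil>c\<rceil>)"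
    by (metis nat_mono ceiling_mono nat_int ceiling_of_nat less_Suc_eq_le)
  moreover have "Q {}" by (simp add: Q_def disjoint_family_on_def)
  ultimately obtain S where S: "Q S" and max: "\<And>S'. Q S' \<Longrightarrow> card S' \<le> card S"
    using ex_has_greatest_nat[of Q "{}" card] by blast
  have fin: "finite S" using S by (simp add: Q_def)
  have cov: "A \<subseteq> (\<Union>x\<in>S. cball x (2 * r))"
  proof
    fix x assume x: "x \<in> A"
    show "x \<in> (\<Union>x\<in>S. cball x (2 * r))"
    proof (cases "x \<in> S")
      case True
      then show ?thesis using r by force
    next
      case notin: False
      have "\<not> Q (insert x S)" using max[of "insert x S"] notin fin by auto
      then obtain y where "y \<in> S" "cball x r \<inter> cball y r \<noteq> {}"
        using S x notin unfolding Q_def disjoint_family_on_def by (auto simp: Int_commute)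
      then obtain z where "dist x z \<le> r" "dist y z \<le> r" by auto
      then have "dist y x \<le> 2 * r" using dist_triangle2[of y x z] by simp
      then show ?thesis using \<open>y \<in> S\<close> by auto
    qed
  qed
  obtain e where e: "bij_betw e {0..<card S} S" using ex_bij_betw_nat_finite[OF fin] by blast
  define U where "U i = (if i < card S then cball (e i) (2 * r) else {})" for i
  have diam: "diameter (cball x (2 * r)) \<le> 4 * r" for x :: 'a
  proof -
    have "dist y z \<le> 4 * r" if "y \<in> cball x (2 * r)" "z \<in> cball x (2 * r)" for y z
      using that dist_triangle3[of y z x] by simp
    then show ?thesis using r by (auto simp: diameter_def intro!: cSUP_least)
  qed
  have "delta_cover (4 * r) A U"
    unfolding delta_cover_def
  proof (intro conjI allI)
    have "\<exists>i<card S. x = e i" if "x \<in> S" for x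
      using e that by (metis atLeastLessThan_iff bij_betw_def image_iff)
    then have "(\<Union>x\<in>S. cball x (2 * r)) \<subseteq> (\<Union>i. U i)"
      by (fastforce simp: U_def)
    then show "A \<subseteq> (\<Union>i. U i)" using cov by (rule subset_trans[rotated])
    show "bounded (U i)" "diameter (U i) \<le> 4 * r" for i
      using r diam by (simp_all add: U_def)
  qed
  then have "hausdorff_content s (4 * r) A \<le> (\<Sum>i. diam_powr s (U i))"
    unfolding hausdorff_content_def by (intro INF_lower) simp
  also have "\<dots> = (\<Sum>i<card S. diam_powr s (U i))"
    by (intro suminf_finite) (auto simp: U_def diam_powr_def)
  also have "\<dots> \<le> (\<Sum>i<card S. ennreal ((4 * r) powr s))"
  proof (intro sum_mono)
    fix i
    show "diam_powr s (U i) \<le> ennreal ((4 * r) powr s)"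
      using s r diam diameter_ge_0[of "cball (e i) (2 * r)"]
      by (auto simp: U_def diam_powr_def intro!: ennreal_leI powr_mono2)
  qed
  also have "\<dots> = ennreal (2 powr s * (real (card S) * (2 * r) powr s))"
  proof -
    have "(4 * r) powr s = 2 powr s * (2 * r) powr s"
      using r powr_mult[of 2 "2 * r" s] by simp
    then show ?thesis by (simp add: ennreal_of_nat_eq_real_of_nat ennreal_mult mult_ac)
  qed
  also have "\<dots> = ennreal (2 powr s) * ennreal (real (card S) * (2 * r) powr s)"
    by (rule ennreal_mult) auto
  also have "\<dots> \<le> ennreal (2 powr s) * packing_content s r A"
    by (intro mult_left_mono le[OF S]) auto
  finally show ?thesis .
qed

lemma hausdorff_content_le_packing_premeasure:
  assumes s: "s \<ge> 0" and \<delta>: "\<delta> > 0"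
  shows "hausdorff_content s \<delta> A \<le> ennreal (2 powr s) * packing_premeasure s A"
proof -
  have "hausdorff_content s \<delta> A \<le> ennreal (2 powr s) * packing_content s \<delta>' A" if "\<delta>' > 0" for \<delta>'
  proof -
    \<comment> \<open>Radius at most \<open>\<delta> / 4\<close> makes the cover admissible for
      \<open>\<delta>\<close>, and radius at most \<open>\<delta>'\<close> makes the packing
      admissible for \<open>\<delta>'\<close>.\<close>
    let ?r = "min (\<delta> / 4) \<delta>'"
    have "hausdorff_content s \<delta> A \<le> hausdorff_content s (4 * ?r) A"
      by (intro hausdorff_content_antimono) auto
    also have "\<dots> \<le> ennreal (2 powr s) * packing_content s ?r A"
      using that \<delta> s by (intro hausdorff_content_le_packing_content) auto
    also have "\<dots> \<le> ennreal (2 powr s) * packing_content s \<delta>' A"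
      by (intro mult_left_mono packing_content_mono) auto
    finally show ?thesis .
  qed
  then show ?thesis
    unfolding packing_premeasure_def by (intro le_ennreal_mult_INF) auto
qed

text \<open>Choose covers of the \<open>B i\<close> that are optimal up to
  \<open>e / 2 ^ (i + 1)\<close> and merge them into one sequence by
  \<open>prod_decode\<close>.\<close>

lemma hausdorff_content_countable_subadditive:
  assumes "A \<subseteq> (\<Union>i. B i)"
  shows "hausdorff_content s \<delta> A \<le> (\<Sum>i. hausdorff_content s \<delta> (B i))"
proof (rule ennreal_le_epsilon)
  fix e :: real
  assume fin: "(\<Sum>i. hausdorff_content s \<delta> (B i)) < top" and e: "0 < e"
  have "\<exists>U. delta_cover \<delta> (B i) U \<and>
     (\<Sum>j. diam_powr s (U j)) \<le> hausdorff_content s \<delta> (B i) + ennreal e * ennreal ((1/2) ^ Suc i)" for i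
  proof -
    have "hausdorff_content s \<delta> (B i) < top" by (rule ennreal_suminf_lessD[OF fin])
    then have "hausdorff_content s \<delta> (B i) < hausdorff_content s \<delta> (B i) + ennreal e * ennreal ((1/2) ^ Suc i)"
      using e by (simp add: ennreal_zero_less_mult_iff flip: less_top)
    then show ?thesis
      unfolding hausdorff_content_def[of s \<delta> "B i"] INF_less_iff by (auto intro: less_imp_le)
  qed
  then obtain U where U: "\<And>i. delta_cover \<delta> (B i) (U i)"
    "\<And>i. (\<Sum>j. diam_powr s (U i j)) \<le> hausdorff_content s \<delta> (B i) + ennreal e * ennreal ((1/2) ^ Suc i)"
    by metis
  have "delta_cover \<delta> A (\<lambda>k. case_prod U (prod_decode k))"
    unfolding delta_cover_def
  proof (intro conjI allI subsetI)
    fix x assume "x \<in> A"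
    then obtain i j where "x \<in> U i j" using assms U(1) unfolding delta_cover_def by blast
    then have "x \<in> case_prod U (prod_decode (prod_encode (i, j)))" by simp
    then show "x \<in> (\<Union>k. case_prod U (prod_decode k))" by (rule UN_I[OF UNIV_I])
  next
    fix k
    show "bounded (case_prod U (prod_decode k))" "diameter (case_prod U (prod_decode k)) \<le> \<delta>"
      using U(1) by (simp_all add: delta_cover_def split_def)
  qed
  then have "hausdorff_content s \<delta> A \<le> (\<Sum>k. diam_powr s (case_prod U (prod_decode k)))"
    unfolding hausdorff_content_def by (intro INF_lower) simp
  also have "\<dots> = (\<Sum>i. \<Sum>j. diam_powr s (U i j))"
    by (rule suminf_ennreal_2dimen[where f = "\<lambda>p. diam_powr s (case_prod U p)"]) simp
  also have "\<dots> \<le> (\<Sum>i. hausdorff_content s \<delta> (B i) + ennreal e * ennreal ((1/2) ^ Suc i))"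
    by (intro suminf_le U(2)) auto
  also have "\<dots> = (\<Sum>i. hausdorff_content s \<delta> (B i)) + (\<Sum>i. ennreal e * ennreal ((1/2) ^ Suc i))"
    by (subst suminf_add) auto
  also have "(\<Sum>i. ennreal e * ennreal ((1/2) ^ Suc i)) = ennreal e"
    unfolding ennreal_suminf_cmult
    by (subst suminf_ennreal_eq[OF zero_le_power power_half_series]) auto
  finally show "hausdorff_content s \<delta> A \<le> (\<Sum>i. hausdorff_content s \<delta> (B i)) + ennreal e" .
qed

text \<open>The Hausdorff content at a fixed scale is countably subadditive, so its bound by the
  packing premeasure survives the passage to countable covers.\<close>

lemma hausdorff_measure_le_packing_measure:
  assumes s: "s \<ge> 0"
  shows "hausdorff_measure s A \<le> ennreal (2 powr s) * packing_measure s A"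
proof -
  have "hausdorff_content s \<delta> A \<le> ennreal (2 powr s) * (\<Sum>i. packing_premeasure s (B i))"
    if "\<delta> > 0" "A \<subseteq> (\<Union>i. B i)" for \<delta> B
  proof -
    have "hausdorff_content s \<delta> A \<le> (\<Sum>i. hausdorff_content s \<delta> (B i))"
      by (rule hausdorff_content_countable_subadditive[OF that(2)])
    also have "\<dots> \<le> (\<Sum>i. ennreal (2 powr s) * packing_premeasure s (B i))"
      by (intro suminf_le hausdorff_content_le_packing_premeasure s that) auto
    finally show ?thesis by simp
  qed
  then have "hausdorff_content s \<delta> A \<le> ennreal (2 powr s) * packing_measure s A" if "\<delta> > 0" for \<delta>
    unfolding packing_measure_def using that by (intro le_ennreal_mult_INF) auto
  then show ?thesis unfolding hausdorff_measure_def by (intro SUP_least) auto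
qed

lemma hausdorff_dim_le_packing_dim: "hausdorff_dim A \<le> packing_dim A"
  unfolding hausdorff_dim_def packing_dim_def
proof (intro Inf_superset_mono subsetI)
  fix x assume "x \<in> {ennreal s |s. 0 \<le> s \<and> packing_measure s A = 0}"
  then show "x \<in> {ennreal s |s. 0 \<le> s \<and> hausdorff_measure s A = 0}"
    using hausdorff_measure_le_packing_measure[of _ A] by fastforce
qed

section \<open>Packing premeasure of sets with an expanding self-map\<close>

text \<open>If the centres were closer, the point dividing the segment between them in the ratio
  \<open>r : r'\<close> would lie in both balls.\<close>

lemma dist_gt_if_disjoint_cballs:
  fixes x y :: "'a::real_normed_vector"
  assumes "cball x r \<inter> cball y r' = {}" "r > 0" "r' > 0"
  shows "dist x y > r + r'"
proof (rule ccontr)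
  assume "\<not> dist x y > r + r'"
  then have d: "norm (y - x) \<le> r + r'" by (simp add: dist_norm norm_minus_commute)
  define u where "u = r / (r + r')"
  have u: "u \<ge> 0" "u * (r + r') = r" "1 - u \<ge> 0" "(1 - u) * (r + r') = r'"
    using assms(2,3) by (simp_all add: u_def field_simps)
  define z where "z = x + u *\<^sub>R (y - x)"
  have "dist x z = u * norm (y - x)" using u by (simp add: z_def dist_norm)
  also have "\<dots> \<le> r" using mult_left_mono[OF d u(1)] u by simp
  finally have "z \<in> cball x r" by simp
  moreover have "y - z = (1 - u) *\<^sub>R (y - x)" by (simp add: z_def algebra_simps)
  then have "dist y z = (1 - u) * norm (y - x)" using u by (simp add: dist_norm)
  then have "dist y z \<le> r'" using mult_left_mono[OF d u(3)] u by simp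
  then have "z \<in> cball y r'" by simp
  ultimately show False using assms(1) by blast
qed

text \<open>The form of disjointness that an expanding map passes on: if distances grow at least by
  a factor, the radii may be multiplied by it.\<close>

definition separated :: "('a::metric_space \<times> real) set \<Rightarrow> bool" where
  "separated C \<longleftrightarrow> (\<forall>p\<in>C. \<forall>q\<in>C. p \<noteq> q \<longrightarrow> dist (fst p) (fst q) > snd p + snd q)"

text \<open>Two centres are more than 2 apart, so each of the unit balls contains at most one of
  them.\<close>

lemma card_separated_le:
  assumes F: "finite F" and cov: "X \<subseteq> (\<Union>k\<in>F. ball k 1)"
    and C: "separated C" "\<And>p. p \<in> C \<Longrightarrow> fst p \<in> X \<and> snd p \<ge> 1"
  shows "card C \<le> card F"
proof -
  have "\<exists>k. k \<in> F \<and> dist k (fst p) < 1" if "p \<in> C" for p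
    using C(2)[OF that] cov by fastforce
  then obtain k where k: "\<And>p. p \<in> C \<Longrightarrow> k p \<in> F \<and> dist (k p) (fst p) < 1" by metis
  have "inj_on k C"
  proof (rule inj_onI, rule ccontr)
    fix p q assume pq: "p \<in> C" "q \<in> C" "k p = k q" "p \<noteq> q"
    then have "dist (fst p) (fst q) > snd p + snd q"
      using C(1) by (simp add: separated_def)
    moreover have "snd p \<ge> 1" "snd q \<ge> 1" using C(2) pq by auto
    moreover have "dist (fst p) (fst q) < 2"
      using k[OF pq(1)] k[OF pq(2)] pq(3) dist_triangle3[of "fst p" "fst q" "k p"] by simp
    ultimately show False by simp
  qed
  then show ?thesis using k by (intro card_inj_on_le[of k C F] F) auto
qed

text \<open>
  Applying \<open>f\<close> to the small balls of a packing that are centred in one piece \<open>P i\<close> yields a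
  packing whose radii are larger by the factor \<open>l i\<close>. As the sum of \<open>l i powr - s\<close> is at most
  \<open>1 / 2\<close>, induction on the order of magnitude of the smallest radius bounds all packing sums.
\<close>

lemma packing_sum_bounded_if_expanding:
  fixes X :: "'a::metric_space set" and l :: "'i \<Rightarrow> real"
  assumes fin: "finite I" and inv: "f ` X \<subseteq> X" and cov: "X \<subseteq> (\<Union>i\<in>I. P i)"
    and exp: "\<And>i x y. i \<in> I \<Longrightarrow> x \<in> X \<inter> P i \<Longrightarrow> y \<in> X \<inter> P i \<Longrightarrow> l i * dist x y \<le> dist (f x) (f y)"
    and l: "\<And>i. i \<in> I \<Longrightarrow> l i \<ge> 2"
    and s: "s > 0" and sum: "(\<Sum>i\<in>I. l i powr - s) \<le> 1 / 2"
    and tb: "finite F" "X \<subseteq> (\<Union>k\<in>F. ball k 1)"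
  obtains A where "A \<ge> 0" "\<And>C. finite C \<Longrightarrow> separated C \<Longrightarrow>
      (\<And>p. p \<in> C \<Longrightarrow> fst p \<in> X \<and> 0 < snd p \<and> snd p \<le> 1) \<Longrightarrow> (\<Sum>p\<in>C. snd p powr s) \<le> A"
proof -
  \<comment> \<open>A common bound for the expansion factors: a radius below 1 stays below
    \<open>L\<close> after one application of \<open>f\<close>. The summand 1 ensures
    \<open>L \<ge> 1\<close>.\<close>
  define L where "L = (\<Sum>i\<in>I. l i) + 1"
  have l0: "l i \<ge> 0" if "i \<in> I" for i using l[OF that] by simp
  have l_le: "l i \<le> L" if "i \<in> I" for i
  proof -
    have "l i \<le> (\<Sum>i\<in>I. l i)" using l0 by (intro member_le_sum that fin) auto
    then show ?thesis by (simp add: L_def)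
  qed
  have L1: "L \<ge> 1" using l0 by (simp add: L_def sum_nonneg)
  define Q where "Q C \<longleftrightarrow> finite C \<and> separated C \<and> (\<forall>p\<in>C. fst p \<in> X \<and> 0 < snd p \<and> snd p \<le> L)" for C
  define A where "A = real (card F) * L powr s"
  have A0: "A \<ge> 0" by (simp add: A_def)
  have large: "(\<Sum>p\<in>C. snd p powr s) \<le> A" if C: "Q C" "\<And>p. p \<in> C \<Longrightarrow> snd p \<ge> 1" for C
  proof -
    have "(\<Sum>p\<in>C. snd p powr s) \<le> (\<Sum>p\<in>C. L powr s)"
      using C s by (intro sum_mono) (auto simp: Q_def less_imp_le intro!: powr_mono2)
    also have "\<dots> = real (card C) * L powr s" by simp
    also have "\<dots> \<le> A"
      unfolding A_def using C card_separated_le[OF tb, of C]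
      by (intro mult_right_mono) (auto simp: Q_def)
    finally show ?thesis .
  qed
  \<comment> \<open>Balls of radius at least 1 contribute at most \<open>A\<close>. The smaller ones
    are pushed forward piece by piece; by induction each image has sum at most \<open>2 * A\<close>,
    and the weights \<open>l i powr - s\<close> reduce the total to \<open>A\<close> again.\<close>
  have main: "(\<Sum>p\<in>C. snd p powr s) \<le> 2 * A" if "Q C" "\<And>p. p \<in> C \<Longrightarrow> snd p \<ge> (1/2) ^ j" for C j
    using that
  proof (induction j arbitrary: C)
    case 0
    then show ?case using large[of C] A0 by simp
  next
    case (Suc j)
    define C1 where "C1 = {p\<in>C. snd p \<ge> 1}"
    define C2 where "C2 = {p\<in>C. snd p < 1}"
    have finC: "finite C" "finite C2" using Suc.prems by (simp_all add: Q_def C2_def)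
    have "\<exists>i. i \<in> I \<and> fst p \<in> P i" if "p \<in> C" for p
      using that Suc.prems(1) cov by (fastforce simp: Q_def)
    then obtain \<iota> where \<iota>: "\<And>p. p \<in> C \<Longrightarrow> \<iota> p \<in> I \<and> fst p \<in> P (\<iota> p)" by metis
    have piece: "(\<Sum>p\<in>{p\<in>C2. \<iota> p = i}. snd p powr s) \<le> l i powr - s * (2 * A)" if i: "i \<in> I" for i
    proof -
      let ?D = "{p\<in>C2. \<iota> p = i}"
      let ?g = "\<lambda>p. (f (fst p), l i * snd p)"
      have li: "l i \<ge> 2" using l i by simp
      have D: "fst p \<in> X" "fst p \<in> P i" "0 < snd p" "snd p < 1" "(1/2) ^ Suc j \<le> snd p" "p \<in> C"
        if "p \<in> ?D" for p
        using that Suc.prems(1) Suc.prems(2)[of p] \<iota>[of p] by (auto simp: C2_def Q_def)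
      have sep: "dist (f (fst p)) (f (fst q)) > l i * snd p + l i * snd q"
        if "p \<in> ?D" "q \<in> ?D" "p \<noteq> q" for p q
      proof -
        have "snd p + snd q < dist (fst p) (fst q)"
          using Suc.prems(1) D(6)[OF that(1)] D(6)[OF that(2)] that(3) by (simp add: Q_def separated_def)
        then have "l i * (snd p + snd q) < l i * dist (fst p) (fst q)" using li by simp
        also have "\<dots> \<le> dist (f (fst p)) (f (fst q))"
          using D[OF that(1)] D[OF that(2)] by (intro exp i) auto
        finally show ?thesis by (simp add: algebra_simps)
      qed
      have pos: "l i * snd p > 0" if "p \<in> ?D" for p using D(3)[OF that] li by simp
      have inj: "inj_on ?g ?D"
      proof (rule inj_onI, rule ccontr)
        fix p q assume pq: "p \<in> ?D" "q \<in> ?D" "?g p = ?g q" "p \<noteq> q"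
        show False using sep[OF pq(1,2,4)] pos[OF pq(1)] pos[OF pq(2)] pq(3) by simp
      qed
      have "Q (?g ` ?D)"
        unfolding Q_def
      proof (intro conjI ballI)
        show "finite (?g ` ?D)" using finC by simp
        show "separated (?g ` ?D)" unfolding separated_def
        proof (intro ballI impI)
          fix p' q' assume "p' \<in> ?g ` ?D" "q' \<in> ?g ` ?D" and ne: "p' \<noteq> q'"
          then obtain p q where pq: "p \<in> ?D" "p' = ?g p" "q \<in> ?D" "q' = ?g q" by blast
          then have "p \<noteq> q" using ne by auto
          from sep[OF pq(1,3) this] show "snd p' + snd q' < dist (fst p') (fst q')"
            by (simp add: pq)
        qed
        fix p' assume "p' \<in> ?g ` ?D"
        then obtain p where p: "p \<in> ?D" "p' = ?g p" by blast
        show "fst p' \<in> X" using D(1)[OF p(1)] inv p(2) by auto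
        show "0 < snd p'" using pos[OF p(1)] p(2) by simp
        have "l i * snd p \<le> l i" using D(4)[OF p(1)] li by simp
        then show "snd p' \<le> L" using l_le[OF i] p(2) by simp
      qed
      moreover have "(1/2) ^ j \<le> snd p'" if p': "p' \<in> ?g ` ?D" for p'
      proof -
        obtain p where p: "p \<in> ?D" "p' = ?g p" using p' by blast
        \<comment> \<open>As \<open>l i \<ge> 2\<close>, the image radii are at least doubled, which
          lowers the induction index by one.\<close>
        have "(1/2) ^ j = 2 * (1/2::real) ^ Suc j" by simp
        also have "\<dots> \<le> l i * snd p" using D(5)[OF p(1)] li by (intro mult_mono) auto
        finally show ?thesis using p by simp
      qed
      ultimately have "(\<Sum>p\<in>?g ` ?D. snd p powr s) \<le> 2 * A" by (rule Suc.IH)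
      also have "(\<Sum>p\<in>?g ` ?D. snd p powr s) = (\<Sum>p\<in>?D. (l i * snd p) powr s)"
        by (subst sum.reindex[OF inj]) simp
      also have "\<dots> = l i powr s * (\<Sum>p\<in>?D. snd p powr s)"
        unfolding sum_distrib_left using D(3) li
        by (intro sum.cong refl powr_mult)
      finally show ?thesis using li by (simp add: powr_minus field_simps)
    qed
    have "(\<Sum>p\<in>C2. snd p powr s) = (\<Sum>i\<in>I. \<Sum>p\<in>{p\<in>C2. \<iota> p = i}. snd p powr s)"
      using \<iota> by (intro sum.group[symmetric] finC fin) (auto simp: C2_def)
    also have "\<dots> \<le> (\<Sum>i\<in>I. l i powr - s * (2 * A))" by (intro sum_mono piece)
    also have "\<dots> = (\<Sum>i\<in>I. l i powr - s) * (2 * A)" by (simp add: sum_distrib_right)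
    also have "\<dots> \<le> 1 / 2 * (2 * A)" using sum A0 by (intro mult_right_mono) auto
    finally have "(\<Sum>p\<in>C2. snd p powr s) \<le> A" by simp
    moreover have "(\<Sum>p\<in>C1. snd p powr s) \<le> A"
      using Suc.prems(1) by (intro large) (auto simp: Q_def C1_def separated_def)
    moreover have "(\<Sum>p\<in>C. snd p powr s) = (\<Sum>p\<in>C1. snd p powr s) + (\<Sum>p\<in>C2. snd p powr s)"
      using finC by (subst sum.union_disjoint[symmetric]) (auto simp: C1_def C2_def intro!: sum.cong)
    ultimately show ?case by simp
  qed
  show thesis
  proof (rule that[of "2 * A"])
    show "2 * A \<ge> 0" using A0 by simp
    fix C :: "('a \<times> real) set"
    assume C: "finite C" "separated C" "\<And>p. p \<in> C \<Longrightarrow> fst p \<in> X \<and> 0 < snd p \<and> snd p \<le> 1"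
    have "\<exists>j. \<forall>p\<in>C. (1/2) ^ j \<le> snd p"
      using C(1,3)
    proof (induction C rule: finite_induct)
      case (insert p C)
      then obtain j where j: "\<forall>p\<in>C. (1/2) ^ j \<le> snd p" by auto
      obtain k where k: "(1/2) ^ k < snd p"
        using insert.prems[of p] real_arch_pow_inv[of "snd p" "1/2"] by auto
      have "(1/2) ^ max j k \<le> (1/2::real) ^ j" "(1/2) ^ max j k \<le> (1/2::real) ^ k"
        by (intro power_decreasing; simp)+
      then have "\<forall>q\<in>insert p C. (1/2) ^ max j k \<le> snd q"
        using j k by (metis insert_iff less_imp_le order_trans)
      then show ?case by blast
    qed auto
    then obtain j where j: "\<And>p. p \<in> C \<Longrightarrow> (1/2) ^ j \<le> snd p" by blast
    show "(\<Sum>p\<in>C. snd p powr s) \<le> 2 * A"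
      using C L1 by (intro main[OF _ j]) (auto simp: Q_def intro: order_trans)
  qed
qed

text \<open>For radii at most \<open>\<delta>\<close>, a sum with exponent \<open>t\<close> is at
  most \<open>\<delta> powr (t - s)\<close> times the bounded sum with exponent \<open>s\<close>, up
  to a constant, and this tends to 0 with \<open>\<delta>\<close>.\<close>

lemma packing_premeasure_eq_0:
  fixes X :: "'a::real_normed_vector set"
  assumes A: "A \<ge> 0" "\<And>C. finite C \<Longrightarrow> separated C \<Longrightarrow>
      (\<And>p. p \<in> C \<Longrightarrow> fst p \<in> X \<and> 0 < snd p \<and> snd p \<le> 1) \<Longrightarrow> (\<Sum>p\<in>C. snd p powr s) \<le> A"
    and st: "s < t"
  shows "packing_premeasure t X = 0"
proof -
  have content: "packing_content t \<delta> X \<le> ennreal (2 powr t * \<delta> powr (t - s) * A)"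
    if \<delta>: "0 < \<delta>" "\<delta> \<le> 1" for \<delta>
    unfolding packing_content_def
  proof (rule SUP_least)
    fix C assume "C \<in> {C. delta_packing \<delta> X C}"
    then have C: "\<And>p. p \<in> C \<Longrightarrow> fst p \<in> X \<and> 0 < snd p \<and> snd p \<le> \<delta>"
      and disj: "disjoint_family_on (\<lambda>(x, r). cball x r) C"
      by (auto simp: delta_packing_def)
    have sep: "separated C" unfolding separated_def
    proof (intro ballI impI)
      fix p q assume pq: "p \<in> C" "q \<in> C" "p \<noteq> q"
      have "cball (fst p) (snd p) \<inter> cball (fst q) (snd q) = {}"
        using disjoint_family_onD[OF disj pq] by (simp add: split_def)
      then show "snd p + snd q < dist (fst p) (fst q)"
        using C[OF pq(1)] C[OF pq(2)] by (intro dist_gt_if_disjoint_cballs) auto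
    qed
    have "(\<Sum>\<^sub>\<infinity>(x, r)\<in>C. ennreal ((2 * r) powr t)) = (\<Sum>\<^sub>\<infinity>p\<in>C. ennreal ((2 * snd p) powr t))"
      by (simp add: split_def)
    also have "\<dots> = (SUP F\<in>{F. finite F \<and> F \<subseteq> C}. \<Sum>p\<in>F. ennreal ((2 * snd p) powr t))"
      by (rule nonneg_infsum_complete) simp
    also have "\<dots> \<le> ennreal (2 powr t * \<delta> powr (t - s) * A)"
    proof (rule SUP_least)
      fix F assume "F \<in> {F. finite F \<and> F \<subseteq> C}"
      then have F: "finite F" "F \<subseteq> C" by auto
      have "(\<Sum>p\<in>F. (2 * snd p) powr t) \<le> (\<Sum>p\<in>F. 2 powr t * \<delta> powr (t - s) * snd p powr s)"
      proof (rule sum_mono)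
        fix p assume "p \<in> F"
        then have p: "0 < snd p" "snd p \<le> \<delta>" using C[of p] F by auto
        have "snd p powr t = snd p powr (t - s) * snd p powr s" by (simp flip: powr_add)
        also have "\<dots> \<le> \<delta> powr (t - s) * snd p powr s"
          using p st by (intro mult_right_mono powr_mono2) auto
        finally show "(2 * snd p) powr t \<le> 2 powr t * \<delta> powr (t - s) * snd p powr s"
          using p by (simp add: powr_mult mult.assoc)
      qed
      also have "\<dots> = 2 powr t * \<delta> powr (t - s) * (\<Sum>p\<in>F. snd p powr s)"
        by (simp add: sum_distrib_left)
      also have "\<dots> \<le> 2 powr t * \<delta> powr (t - s) * A"
      proof (rule mult_left_mono[OF A(2)])
        show "separated F" using sep F(2) unfolding separated_def by blast
        show "fst p \<in> X \<and> 0 < snd p \<and> snd p \<le> 1" if "p \<in> F" for p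
          using C[of p] that F \<delta> by auto
      qed (use F in auto)
      finally show "(\<Sum>p\<in>F. ennreal ((2 * snd p) powr t)) \<le> ennreal (2 powr t * \<delta> powr (t - s) * A)"
        by (subst sum_ennreal) (auto intro!: ennreal_leI)
    qed
    finally show "(\<Sum>\<^sub>\<infinity>(x, r)\<in>C. ennreal ((2 * r) powr t)) \<le> ennreal (2 powr t * \<delta> powr (t - s) * A)" .
  qed
  have "packing_premeasure t X \<le> ennreal (2 powr t * \<delta> powr (t - s) * A)" if "0 < \<delta>" "\<delta> \<le> 1" for \<delta>
    unfolding packing_premeasure_def using that content[OF that] by (intro INF_lower2[of \<delta>]) auto
  then have "\<forall>\<^sub>F \<delta> in at_right 0. packing_premeasure t X \<le> ennreal (2 powr t * \<delta> powr (t - s) * A)"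
    by (intro eventually_at_rightI[of 0 1]) auto
  moreover have "((\<lambda>\<delta>. ennreal (2 powr t * \<delta> powr (t - s) * A)) \<longlongrightarrow> ennreal (2 powr t * 0 * A)) (at_right 0)"
  proof (intro tendsto_ennrealI tendsto_intros)
    show "((\<lambda>\<delta>. \<delta> powr (t - s)) \<longlongrightarrow> 0) (at_right 0)"
      using st by (auto intro!: tendsto_eq_intros eventually_at_rightI[of 0 1] filterlim_ident simp: tendsto_powr2)
  qed
  ultimately have "packing_premeasure t X \<le> ennreal (2 powr t * 0 * A)"
    by (intro tendsto_lowerbound) auto
  then show ?thesis by simp
qed

lemma packing_measure_eq_0:
  assumes "A \<subseteq> (\<Union>i::nat. B i)" "\<And>i. packing_premeasure s (B i) = 0"
  shows "packing_measure s A = 0"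
proof -
  have "packing_measure s A \<le> (\<Sum>i. packing_premeasure s (B i))"
    unfolding packing_measure_def using assms(1) by (intro INF_lower) simp
  then show ?thesis by (simp add: assms(2))
qed

section \<open>A power series with rapidly decreasing coefficients\<close>

text \<open>For use with a value \<open>x\<close> of a series, its two dominant terms
  \<open>u\<close> and \<open>v\<close>, and the error \<open>e\<close> of the remaining
  terms.\<close>

lemma norm_near_sum:
  fixes x u v :: "'a::real_normed_vector"
  assumes "norm (x - (u + v)) \<le> e"
  shows "norm x \<le> e + (norm u + norm v)" "norm u \<le> norm x + norm v + e" "norm v \<le> norm x + norm u + e"
  using assms by norm+

locale lacunary_series =
  fixes W :: real
  assumes W: "W \<ge> 2 ^ 30"
begin

text \<open>
  Here \<open>a n = c n / c (n + 1)\<close> and \<open>y n = a (n + 1) / a n\<close>. The recursion for \<open>y\<close> is the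
  one that makes the value \<open>c n * a n ^ (n + 1)\<close> of the two leading terms at \<open>a n\<close> equal to
  \<open>64 ^ (n + 1) * a (n + 1)\<close>, so that \<open>f\<close> maps the scale \<open>a n\<close> slightly above the next one.
\<close>

primrec y :: "nat \<Rightarrow> real" where
  "y 0 = 64 * W"
| "y (Suc n) = y n ^ (n + 2) / 64"

primrec a :: "nat \<Rightarrow> real" where
  "a 0 = 1"
| "a (Suc n) = y n * a n"

primrec c :: "nat \<Rightarrow> real" where
  "c 0 = 64 * y 0"
| "c (Suc n) = c n / a n"

declare y.simps(2) [simp del] a.simps(2) [simp del] c.simps(2) [simp del]

text \<open>The modulus of the term of index \<open>n\<close> on the circle of radius
  \<open>r\<close>.\<close>

definition T :: "nat \<Rightarrow> real \<Rightarrow> real" where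
  "T n r = c n * r ^ (n + 1)"

text \<open>The range of radii on which the terms of index \<open>n\<close> and \<open>n + 1\<close>
  dominate. Consecutive levels share a boundary circle, and level 0 contains the origin.\<close>

definition level :: "nat \<Rightarrow> real \<Rightarrow> bool" where
  "level n r \<longleftrightarrow> 0 \<le> r \<and> r \<le> a (Suc n) / 2 ^ 15 \<and> (n = 0 \<or> a n / 2 ^ 15 \<le> r)"

definition f :: "complex \<Rightarrow> complex" where
  "f z = (\<Sum>k. of_real (c k) * z ^ (k + 1))"

definition f' :: "complex \<Rightarrow> complex" where
  "f' z = (\<Sum>k. of_nat (k + 1) * of_real (c k) * z ^ k)"

section \<open>Growth of the scales and coefficients\<close>

text \<open>By the recursion \<open>y (n + 1)\<close> is at least \<open>y n ^ 2 / 64\<close>, and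
  squaring doubles the exponent \<open>n + 1\<close>, which is more than the step to
  \<open>n + 2\<close> requires.\<close>

lemma y_ge: "64 * W ^ (n + 1) \<le> y n"
proof (induction n)
  case (Suc n)
  have W1: "W \<ge> 1" using W by simp
  have "64 * W ^ (Suc n + 1) \<le> 64 * W ^ (2 * (n + 1))"
    using W1 by (intro mult_left_mono power_increasing) auto
  also have "\<dots> = (64 * W ^ (n + 1)) ^ 2 / 64"
    by (simp add: power_mult_distrib power_mult[symmetric] mult.commute del: power_Suc)
  also have "\<dots> \<le> y n ^ 2 / 64"
    using Suc.IH W1 by (intro divide_right_mono power_mono) auto
  also have "\<dots> \<le> y n ^ (n + 2) / 64"
  proof -
    have "1 \<le> 64 * W ^ (n + 1)" using one_le_power[OF W1, of "n + 1"] by linarith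
    then have "1 \<le> y n" using Suc.IH by linarith
    then show ?thesis by (intro divide_right_mono power_increasing) auto
  qed
  finally show ?case by (simp add: y.simps)
qed simp

lemma y_large: "2 ^ 30 \<le> y n"
proof -
  have "W \<le> W ^ (n + 1)" using W by (intro self_le_power) auto
  then have "2 ^ 30 \<le> W ^ (n + 1)" using W by (rule order_trans[rotated])
  then show ?thesis using y_ge[of n] by simp
qed

lemma y_pos: "0 < y n" using y_large[of n] by simp

lemma a_pos: "0 < a n"
  by (induction n) (use y_pos in \<open>auto simp: a.simps\<close>)

lemma c_pos: "0 < c n"
  by (induction n) (use W a_pos in \<open>auto simp: c.simps\<close>)

lemma a_Suc_ge: "2 ^ 30 * a n \<le> a (Suc n)"
  using mult_right_mono[OF y_large[of n], of "a n"] a_pos[of n] by (simp add: a.simps)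

lemma a_mono: "m \<le> n \<Longrightarrow> a m \<le> a n"
proof (induction n rule: dec_induct)
  case (step n)
  then show ?case using a_Suc_ge[of n] a_pos[of n] by simp
qed simp

lemma a_ge: "2 ^ n \<le> a n"
proof (induction n)
  case (Suc n)
  then show ?case using a_Suc_ge[of n] a_pos[of n] by simp
qed simp

text \<open>Passing from \<open>n\<close> to \<open>n + 1\<close> multiplies the left side by
  \<open>y n ^ (n + 2)\<close>, which equals \<open>64 * y (n + 1)\<close> by the recursion.\<close>

lemma c_a: "c n * a n ^ (n + 1) = 64 ^ (n + 1) * a (Suc n)"
proof (induction n)
  case (Suc n)
  have "c (Suc n) * a (Suc n) ^ (Suc n + 1) = (c n * a n ^ (n + 1)) * y n ^ (n + 2)"
    using a_pos[of n] by (simp add: a.simps c.simps power_mult_distrib field_simps)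
  also have "\<dots> = 64 ^ (n + 1) * a (Suc n) * y n ^ (n + 2)" by (simp only: Suc)
  also have "\<dots> = 64 ^ (Suc n + 1) * a (Suc (Suc n))" by (simp add: a.simps y.simps)
  finally show ?case .
qed (simp add: a.simps)

lemma T_nonneg: "0 \<le> r \<Longrightarrow> 0 \<le> T n r"
  using c_pos[of n] by (simp add: T_def)

lemma T_Suc: "T (Suc n) r = T n r * (r / a n)"
  by (simp add: T_def c.simps)

section \<open>The two dominant terms of the series on a level\<close>

lemma ex_level:
  assumes "0 \<le> r"
  shows "\<exists>n. level n r"
proof -
  obtain m :: nat where m: "r * 2 ^ 15 \<le> real m" using real_arch_simple by blast
  have "real m < 2 ^ m" by (rule of_nat_less_two_power)
  then have "real m \<le> a (Suc m)" using a_ge[of m] a_mono[of m "Suc m"] by linarith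
  then have ex: "r \<le> a (Suc m) / 2 ^ 15" using m by (simp add: field_simps)
  define n where "n = (LEAST n. r \<le> a (Suc n) / 2 ^ 15)"
  have "r \<le> a (Suc n) / 2 ^ 15" unfolding n_def using ex by (rule LeastI)
  moreover have "n = 0 \<or> a n / 2 ^ 15 \<le> r"
  proof (cases n)
    case (Suc k)
    then have "\<not> r \<le> a (Suc k) / 2 ^ 15" unfolding n_def by (metis lessI not_less_Least)
    then show ?thesis using Suc by simp
  qed simp
  ultimately show ?thesis using assms by (auto simp: level_def)
qed

text \<open>Successive terms have ratio \<open>r / a k\<close>, which is at most
  \<open>1 / 2 ^ 15\<close> for \<open>k > n\<close>.\<close>

lemma T_above:
  assumes "level n r"
  shows "T (Suc n + j) r \<le> (1 / 2 ^ 15) ^ j * T (Suc n) r"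
proof (induction j)
  case (Suc j)
  have r: "0 \<le> r" "r \<le> a (Suc n) / 2 ^ 15" using assms by (auto simp: level_def)
  have "r / a (Suc n + j) \<le> r / a (Suc n)"
    using r a_pos a_mono[of "Suc n" "Suc n + j"] a_pos[of "Suc n"] a_pos[of "Suc n + j"] by (intro divide_left_mono mult_pos_pos) auto
  also have "\<dots> \<le> 1 / 2 ^ 15" using r a_pos[of "Suc n"] by (simp add: field_simps)
  finally have "T (Suc n + j) r * (r / a (Suc n + j)) \<le> T (Suc n + j) r * (1 / 2 ^ 15)"
    by (intro mult_left_mono T_nonneg r)
  then show ?case using Suc T_Suc[of "Suc n + j" r] by simp
qed simp

text \<open>For \<open>k < n\<close> the ratio \<open>r / a k\<close> is at least
  \<open>2 ^ 15\<close>, since \<open>a k\<close> is at most \<open>a n / 2 ^ 30\<close> and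
  \<open>r\<close> at least \<open>a n / 2 ^ 15\<close>.\<close>

lemma T_below:
  assumes "level n r" "k \<le> n"
  shows "T k r \<le> (1 / 2 ^ 15) ^ (n - k) * T n r"
  using assms(2)
proof (induction k rule: inc_induct)
  case (step k)
  then obtain m where m: "n = Suc m" "k \<le> m" by (cases n) auto
  have r: "a n / 2 ^ 15 \<le> r" using assms(1) m by (simp add: level_def)
  then have rpos: "0 < r" using a_pos[of n] by (smt (verit) divide_pos_pos zero_less_power)
  have "a k \<le> a m" using m by (intro a_mono) auto
  also have "a m \<le> a n / 2 ^ 30" using a_Suc_ge[of m] m by simp
  also have "\<dots> \<le> r / 2 ^ 15" using r by simp
  finally have "1 \<le> (1 / 2 ^ 15) * (r / a k)" using a_pos[of k] by (simp add: field_simps)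
  then have "T k r * 1 \<le> T k r * ((1 / 2 ^ 15) * (r / a k))"
    using rpos by (intro mult_left_mono T_nonneg) auto
  also have "\<dots> = (1 / 2 ^ 15) * T (Suc k) r" by (simp add: T_Suc)
  also have "\<dots> \<le> (1 / 2 ^ 15) * ((1 / 2 ^ 15) ^ (n - Suc k) * T n r)"
    by (intro mult_left_mono step.IH) auto
  also have "\<dots> = (1 / 2 ^ 15) ^ Suc (n - Suc k) * T n r" by simp
  also have "Suc (n - Suc k) = n - k" using step.hyps by simp
  finally show ?case by simp
qed simp

text \<open>The linear growth of \<open>b\<close> costs a factor 2 per index, so the remaining terms
  still decay geometrically with ratio \<open>1 / 2 ^ 14\<close>. The weights \<open>b\<close> allow
  one estimate to serve \<open>f\<close>, \<open>z * f' z\<close> and the combination of both in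
  which one dominant term cancels.\<close>

lemma two_term_approximation:
  fixes z :: complex and b :: "nat \<Rightarrow> complex"
  assumes lev: "level n (norm z)" and B: "0 \<le> B"
    and b: "\<And>k. norm (b k) \<le> B * (1 + \<bar>real k - real n\<bar>)"
  shows "summable (\<lambda>k. b k * of_real (c k) * z ^ (k + 1))" (is "summable ?g")
    and "norm ((\<Sum>k. b k * of_real (c k) * z ^ (k + 1)) -
        (b n * of_real (c n) * z ^ (n + 1) + b (Suc n) * of_real (c (Suc n)) * z ^ (n + 2)))
      \<le> B / 4096 * (T n (norm z) + T (Suc n) (norm z))"
proof -
  let ?r = "norm z"
  have norm_g: "norm (?g k) = norm (b k) * T k ?r" for k
    using c_pos[of k] by (simp add: T_def norm_mult norm_power mult.assoc)
  have one_le: "1 + real m \<le> 2 ^ m" for m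
  proof (induction m)
    case (Suc m)
    have "1 \<le> (2::real) ^ m" by simp
    then show ?case using Suc by simp
  qed simp
  have above: "norm (?g (j + (n + 2))) \<le> B * T (Suc n) ?r / 2 ^ 13 * (1 / 2 ^ 14) ^ j" for j
  proof -
    have "norm (?g (j + (n + 2))) \<le> (B * (1 + real (j + 2))) * ((1 / 2 ^ 15) ^ Suc j * T (Suc n) ?r)"
      unfolding norm_g using b[of "j + (n + 2)"] T_above[OF lev, of "Suc j"] B
      by (intro mult_mono T_nonneg) (auto simp: add_ac)
    also have "\<dots> \<le> (B * 2 ^ (j + 2)) * ((1 / 2 ^ 15) ^ Suc j * T (Suc n) ?r)"
      using one_le[of "j + 2"] B by (intro mult_right_mono mult_left_mono mult_nonneg_nonneg T_nonneg) auto
    also have "\<dots> = B * T (Suc n) ?r * 2 * (2 * (1 / 2 ^ 15)) ^ Suc j"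
      by (simp only: power_mult_distrib) simp
    also have "2 * (1 / 2 ^ 15) = (1 / 2 ^ 14 :: real)" by simp
    also have "B * T (Suc n) ?r * 2 * (1 / 2 ^ 14) ^ Suc j = B * T (Suc n) ?r / 2 ^ 13 * (1 / 2 ^ 14) ^ j" by simp
    finally show ?thesis .
  qed
  have geo: "summable (\<lambda>j. B * T (Suc n) ?r / 2 ^ 13 * (1 / 2 ^ 14) ^ j)"
    by (intro summable_mult summable_geometric) simp
  have sum_shift: "summable (\<lambda>j. norm (?g (j + (n + 2))))"
    by (rule summable_comparison_test'[OF geo, of 0]) (use above in auto)
  show sm: "summable ?g"
    using summable_norm_cancel[OF sum_shift] by (subst (asm) summable_iff_shift)
  have tail: "norm (\<Sum>j. ?g (j + (n + 2))) \<le> B / 4096 * T (Suc n) ?r"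
  proof -
    have "norm (\<Sum>j. ?g (j + (n + 2))) \<le> (\<Sum>j. norm (?g (j + (n + 2))))"
      by (rule summable_norm[OF sum_shift])
    also have "\<dots> \<le> (\<Sum>j. B * T (Suc n) ?r / 2 ^ 13 * (1 / 2 ^ 14) ^ j)"
      by (intro suminf_le above sum_shift geo)
    also have "\<dots> = B * T (Suc n) ?r / 2 ^ 13 * (1 / (1 - 1 / 2 ^ 14))"
      by (subst suminf_mult) (simp_all add: suminf_geometric)
    also have "\<dots> \<le> B * T (Suc n) ?r / 2 ^ 13 * 2"
      using B by (intro mult_left_mono divide_nonneg_nonneg mult_nonneg_nonneg T_nonneg) auto
    finally show ?thesis by simp
  qed
  have head: "norm (\<Sum>k<n. ?g k) \<le> B / 4096 * T n ?r"
  proof -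
    have "norm (?g k) \<le> B * T n ?r * (1 / 2 ^ 14) ^ (n - k)" if "k < n" for k
    proof -
      have "norm (?g k) \<le> (B * (1 + real (n - k))) * ((1 / 2 ^ 15) ^ (n - k) * T n ?r)"
        unfolding norm_g using b[of k] T_below[OF lev, of k] B that
        by (intro mult_mono T_nonneg) (auto simp: of_nat_diff)
      also have "\<dots> \<le> (B * 2 ^ (n - k)) * ((1 / 2 ^ 15) ^ (n - k) * T n ?r)"
        using one_le[of "n - k"] B by (intro mult_right_mono mult_left_mono mult_nonneg_nonneg T_nonneg) auto
      also have "\<dots> = B * T n ?r * (2 * (1 / 2 ^ 15)) ^ (n - k)"
        by (simp only: power_mult_distrib) simp
      finally show ?thesis by simp
    qed
    then have "norm (\<Sum>k<n. ?g k) \<le> (\<Sum>k<n. B * T n ?r * (1 / 2 ^ 14) ^ (n - k))"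
      by (intro sum_norm_le) auto
    also have "\<dots> = B * T n ?r * (\<Sum>k<n. (1 / 2 ^ 14) ^ (n - k))"
      by (simp add: sum_distrib_left)
    \<comment> \<open>Reversing the order of summation turns the head into a geometric sum as
      well.\<close>
    also have "(\<Sum>k<n. (1 / 2 ^ 14 :: real) ^ (n - k)) = (\<Sum>k<n. (1 / 2 ^ 14) ^ Suc k)"
      by (rule sum.reindex_bij_witness[of _ "\<lambda>k. n - Suc k" "\<lambda>k. n - Suc k"]) (auto simp: Suc_diff_Suc)
    also have "\<dots> = (1 / 2 ^ 14) * (\<Sum>k<n. (1 / 2 ^ 14) ^ k)"
      by (simp add: sum_distrib_left)
    also have "B * T n ?r * \<dots> \<le> B * T n ?r * ((1 / 2 ^ 14) * 2)"
    proof (intro mult_left_mono mult_nonneg_nonneg B T_nonneg)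
      have "(\<Sum>k<n. (1 / 2 ^ 14 :: real) ^ k) \<le> (\<Sum>k. (1 / 2 ^ 14) ^ k)"
        by (intro sum_le_suminf summable_geometric) auto
      also have "\<dots> \<le> 2" by (subst suminf_geometric) auto
      finally show "(\<Sum>k<n. (1 / 2 ^ 14 :: real) ^ k) \<le> 2" .
    qed auto
    also have "\<dots> \<le> B / 4096 * T n ?r"
      using B T_nonneg[of ?r n] by (simp add: mult.commute mult_left_mono)
    finally show ?thesis .
  qed
  have "(\<Sum>k. ?g k) = (\<Sum>j. ?g (j + (n + 2))) + (\<Sum>k<n + 2. ?g k)"
    by (rule suminf_split_initial_segment[OF sm])
  also have "(\<Sum>k<n + 2. ?g k) = (\<Sum>k<n. ?g k) + (?g n + ?g (Suc n))" by (simp add: add.assoc)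
  finally have "(\<Sum>k. ?g k) - (?g n + ?g (Suc n)) = (\<Sum>j. ?g (j + (n + 2))) + (\<Sum>k<n. ?g k)"
    by simp
  also have "norm \<dots> \<le> B / 4096 * T (Suc n) ?r + B / 4096 * T n ?r"
    by (rule order_trans[OF norm_triangle_ineq add_mono[OF tail head]])
  finally show "norm ((\<Sum>k. ?g k) - (?g n + b (Suc n) * of_real (c (Suc n)) * z ^ (n + 2)))
      \<le> B / 4096 * (T n ?r + T (Suc n) ?r)" by (simp add: algebra_simps)
qed

section \<open>The entire function and its derivative\<close>

lemma f_summable: "summable (\<lambda>k. of_real (c k) * z ^ (k + 1) :: complex)"
proof -
  obtain n where "level n (norm z)" using ex_level[of "norm z"] by auto
  from two_term_approximation(1)[OF this, of 1 "\<lambda>_. 1"] show ?thesis by simp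
qed

lemma f_has_field_derivative: "(f has_field_derivative f' z) (at z)"
proof -
  \<comment> \<open>The series for \<open>f\<close> starts with the power \<open>z ^ 1\<close>; the
    index shift brings it into the standard form of a power series.\<close>
  define d :: "nat \<Rightarrow> complex" where "d n = (case n of 0 \<Rightarrow> 0 | Suc k \<Rightarrow> of_real (c k))" for n
  have sm: "summable (\<lambda>n. d n * w ^ n)" for w
    using f_summable[of w] by (subst summable_Suc_iff[symmetric]) (simp add: d_def)
  have "f = (\<lambda>w. \<Sum>n. d n * w ^ n)"
  proof
    fix w
    show "f w = (\<Sum>n. d n * w ^ n)"
      using suminf_split_head[OF sm[of w]] by (simp add: f_def d_def)
  qed
  moreover have "f' z = (\<Sum>n. diffs d n * z ^ n)"
    by (simp add: f'_def diffs_def d_def)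
  ultimately show ?thesis using termdiffs_strong_converges_everywhere[OF sm, of z] by simp
qed

lemma norm_of_nat_Suc_le: "norm (of_nat (k + 1) :: complex) \<le> (real n + 1) * (1 + \<bar>real k - real n\<bar>)"
proof -
  have "real k + 1 \<le> real n + 1 + \<bar>real k - real n\<bar>" by linarith
  also have "\<dots> \<le> (real n + 1) * (1 + \<bar>real k - real n\<bar>)" by (simp add: algebra_simps)
  finally show ?thesis by (subst norm_of_nat) (simp only: of_nat_add of_nat_1)
qed

text \<open>The factor \<open>z\<close> restores the powers \<open>z ^ (k + 1)\<close>, so that the
  two-term approximation applies to the derivative.\<close>

lemma f'_times:
  assumes "level n (norm z)"
  shows "z * f' z = (\<Sum>k. of_nat (k + 1) * of_real (c k) * z ^ (k + 1))"
    and "summable (\<lambda>k. of_nat (k + 1) * of_real (c k) * z ^ (k + 1))"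
proof -
  from two_term_approximation(1)[OF assms _ norm_of_nat_Suc_le]
  show sm: "summable (\<lambda>k. of_nat (k + 1) * of_real (c k) * z ^ (k + 1))" by simp
  show "z * f' z = (\<Sum>k. of_nat (k + 1) * of_real (c k) * z ^ (k + 1))"
  proof (cases "z = 0")
    case False
    have "(\<lambda>k. 1 / z * (of_nat (k + 1) * of_real (c k) * z ^ (k + 1))) = (\<lambda>k. of_nat (k + 1) * of_real (c k) * z ^ k)"
      using False by (simp add: mult.assoc)
    with summable_mult[OF sm, of "1 / z"]
    have "summable (\<lambda>k. of_nat (k + 1) * of_real (c k) * z ^ k)" by simp
    from suminf_mult[OF this, of z] show ?thesis by (simp add: f'_def algebra_simps)
  qed simp
qed

lemma f_approx:
  assumes "level n (norm z)"
  shows "norm (f z - (of_real (c n) * z ^ (n + 1) + of_real (c (Suc n)) * z ^ (n + 2)))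
    \<le> (T n (norm z) + T (Suc n) (norm z)) / 4096"
  using two_term_approximation(2)[OF assms, of 1 "\<lambda>_. 1"] by (simp add: f_def)

lemma norm_term: "norm (of_real (c n) * z ^ (n + 1) :: complex) = T n (norm z)"
  using c_pos[of n] by (simp add: T_def norm_mult norm_power)

lemma norm_term_Suc: "norm (of_real (c (Suc n)) * z ^ (n + 2) :: complex) = T (Suc n) (norm z)"
  using norm_term[of "Suc n" z] by simp

section \<open>Images of the levels and escape\<close>

lemma norm_f_le:
  assumes "level n (norm z)"
  shows "norm (f z) \<le> 2 * (T n (norm z) + T (Suc n) (norm z))"
proof -
  have "norm (f z) \<le> (T n (norm z) + T (Suc n) (norm z)) / 4096 + (T n (norm z) + T (Suc n) (norm z))"
    using norm_near_sum(1)[OF f_approx[OF assms]] unfolding norm_term norm_term_Suc .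
  then show ?thesis using T_nonneg[OF norm_ge_zero, of n z] T_nonneg[OF norm_ge_zero, of "Suc n" z] by argo
qed

text \<open>The bound is largest on the outer circle of radius \<open>R\<close>, where the term of
  index \<open>n + 1\<close> dominates. Its value at \<open>a (n + 1)\<close> is known from
  \<open>c_a\<close>, and shrinking the radius to \<open>R\<close> leaves a factor of at most
  \<open>(64 / 2 ^ 15) ^ 2 = 1 / 2 ^ 18\<close>.\<close>

lemma norm_f_less:
  assumes lev: "level n (norm z)"
  shows "norm (f z) < a (Suc (Suc n)) / 2 ^ 15"
proof -
  define R where "R = a (Suc n) / 2 ^ 15"
  have r: "0 \<le> norm z" "norm z \<le> R" using lev by (auto simp: level_def R_def)
  have R: "a n \<le> R" using a_Suc_ge[of n] a_pos[of n] by (simp add: R_def)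
  have mono: "T k (norm z) \<le> T k R" for k
    using r c_pos[of k] unfolding T_def by (intro mult_left_mono power_mono) auto
  have "T n R * 1 \<le> T n R * (R / a n)"
    using R a_pos[of n] by (intro mult_left_mono T_nonneg) (auto simp: field_simps)
  then have 1: "T n R \<le> T (Suc n) R" by (simp add: T_Suc)
  have "T (Suc n) R = c (Suc n) * a (Suc n) ^ (Suc n + 1) / (2 ^ 15) ^ (Suc n + 1)"
    by (simp add: T_def R_def power_divide)
  also have "\<dots> = (64 / 2 ^ 15) ^ (Suc n + 1) * a (Suc (Suc n))"
    unfolding c_a by (simp only: power_divide) simp
  also have "\<dots> \<le> (64 / 2 ^ 15) ^ 2 * a (Suc (Suc n))"
    using a_pos[of "Suc (Suc n)"] by (intro mult_right_mono power_decreasing) auto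
  finally have 2: "T (Suc n) R \<le> a (Suc (Suc n)) / 2 ^ 18" by (simp add: power2_eq_square)
  have "norm (f z) \<le> 4 * T (Suc n) R" using norm_f_le[OF lev] mono[of n] mono[of "Suc n"] 1 by simp
  also have "\<dots> < a (Suc (Suc n)) / 2 ^ 15" using 2 a_pos[of "Suc (Suc n)"] by simp
  finally show ?thesis .
qed

text \<open>Beyond \<open>2 * a n\<close> the term of index \<open>n + 1\<close> is at least twice
  that of index \<open>n\<close>, which in turn is at least \<open>64 * a (n + 1)\<close>; so their
  difference already exceeds the next threshold.\<close>

lemma escape_step:
  assumes "2 * a n < norm z" "norm z < a (Suc n) / 2 ^ 15"
  shows "2 * a (Suc n) < norm (f z)" "norm (f z) < a (Suc (Suc n)) / 2 ^ 15"
proof -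
  let ?r = "norm z"
  have lev: "level n ?r" using assms a_pos[of n] by (auto simp: level_def)
  show "norm (f z) < a (Suc (Suc n)) / 2 ^ 15" by (rule norm_f_less[OF lev])
  have "T n ?r * 2 \<le> T n ?r * (?r / a n)"
    using assms a_pos[of n] by (intro mult_left_mono T_nonneg) (auto simp: field_simps)
  then have 1: "2 * T n ?r \<le> T (Suc n) ?r" by (simp add: T_Suc)
  have "64 * a (Suc n) \<le> 64 ^ (n + 1) * a (Suc n)"
    using a_pos[of "Suc n"] by (intro mult_right_mono self_le_power) auto
  also have "\<dots> = c n * a n ^ (n + 1)" by (rule c_a[symmetric])
  also have "\<dots> \<le> T n ?r"
    using assms a_pos[of n] c_pos[of n] unfolding T_def by (intro mult_left_mono power_mono) auto
  finally have 2: "64 * a (Suc n) \<le> T n ?r" .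
  have "T (Suc n) ?r \<le> norm (f z) + T n ?r + (T n ?r + T (Suc n) ?r) / 4096"
    using norm_near_sum(3)[OF f_approx[OF lev]] unfolding norm_term norm_term_Suc .
  then show "2 * a (Suc n) < norm (f z)" using 1 2 a_pos[of "Suc n"] by argo
qed

section \<open>Lower bound for the derivative\<close>

lemma times_f'_approx:
  assumes "level n (norm z)"
  shows "norm (z * f' z - (of_nat (n + 1) * (of_real (c n) * z ^ (n + 1)) +
      of_nat (n + 2) * (of_real (c (Suc n)) * z ^ (n + 2))))
    \<le> (real n + 1) / 4096 * (T n (norm z) + T (Suc n) (norm z))"
  using two_term_approximation(2)[OF assms _ norm_of_nat_Suc_le] f'_times(1)[OF assms]
  by (simp add: algebra_simps)

text \<open>The combination has the weights \<open>k - n - 1\<close>: the term of index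
  \<open>n + 1\<close> cancels and that of index \<open>n\<close> remains with weight -1.\<close>

lemma times_f'_minus_f_approx:
  assumes "level n (norm z)"
  shows "norm (z * f' z - of_nat (n + 2) * f z + of_real (c n) * z ^ (n + 1))
    \<le> (T n (norm z) + T (Suc n) (norm z)) / 4096"
proof -
  let ?b = "\<lambda>k. of_nat (k + 1) - of_nat (n + 2) :: complex"
  have "norm (?b k) \<le> 1 * (1 + \<bar>real k - real n\<bar>)" for k
  proof -
    have "?b k = of_real (real k - real n - 1)" by simp
    then have "norm (?b k) = \<bar>real k - real n - 1\<bar>" by (simp only: norm_of_real)
    then show ?thesis by simp
  qed
  note approx = two_term_approximation(2)[OF assms _ this]
  have b: "?b n = - 1" "?b (Suc n) = 0" by simp_all
  have "(\<Sum>k. ?b k * of_real (c k) * z ^ (k + 1)) =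
      (\<Sum>k. of_nat (k + 1) * of_real (c k) * z ^ (k + 1) - of_nat (n + 2) * (of_real (c k) * z ^ (k + 1)))"
    by (simp add: algebra_simps)
  also have "\<dots> = (\<Sum>k. of_nat (k + 1) * of_real (c k) * z ^ (k + 1)) -
      (\<Sum>k. of_nat (n + 2) * (of_real (c k) * z ^ (k + 1)))"
    by (intro suminf_diff[symmetric] f'_times(2)[OF assms] summable_mult f_summable)
  also have "\<dots> = z * f' z - of_nat (n + 2) * f z"
    using f'_times(1)[OF assms] suminf_mult[OF f_summable[of z], of "of_nat (n + 2)"]
    by (simp add: f_def)
  finally have "(\<Sum>k. ?b k * of_real (c k) * z ^ (k + 1)) = z * f' z - of_nat (n + 2) * f z" .
  with approx show ?thesis unfolding b by simp
qed

text \<open>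
  If \<open>norm z \<le> a n / 4\<close>, the term of index \<open>n\<close> dominates \<open>z * f' z\<close>. Otherwise that term is
  much larger than \<open>a (n + 1)\<close>, and \<open>z * f' z - (n + 2) * f z\<close>, in which the term of index
  \<open>n + 1\<close> cancels, shows that \<open>f' z\<close> can only be small where \<open>f z\<close> is large.
\<close>

lemma norm_f'_ge:
  assumes lev: "level n (norm z)" and r: "norm z \<le> 2 * a n" and fz: "norm (f z) \<le> 2 * a (Suc n)"
  shows "c n * (a n / 2 ^ 15) ^ n / 4 \<le> norm (f' z)"
proof (cases "z = 0")
  case True
  then have "n = 0" using lev a_pos[of n] by (auto simp: level_def)
  moreover have "f' 0 = of_real (c 0)"
    unfolding f'_def by (subst suminf_finite[of "{0}"]) auto
  ultimately show ?thesis using True c_pos[of 0] by simp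
next
  case False
  let ?r = "norm z"
  have T0: "0 \<le> T n ?r" "0 \<le> T (Suc n) ?r" by (simp_all add: T_nonneg)
  have "T n ?r / 4 \<le> norm (z * f' z)"
  proof (cases "?r \<le> a n / 4")
    case True
    have "T n ?r * (?r / a n) \<le> T n ?r * (1 / 4)"
      using True a_pos[of n] by (intro mult_left_mono T0) (auto simp: field_simps)
    then have 1: "T (Suc n) ?r \<le> T n ?r / 4" by (simp add: T_Suc)
    have "(real n + 1) * T n ?r \<le> norm (z * f' z) + (real n + 2) * T (Suc n) ?r +
        (real n + 1) / 4096 * (T n ?r + T (Suc n) ?r)"
    proof -
      have *: "norm (of_nat (n + 1) * (of_real (c n) * z ^ (n + 1)) :: complex) = (real n + 1) * T n ?r"
        by (subst norm_mult, subst norm_term, subst norm_of_nat) simp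
      have **: "norm (of_nat (n + 2) * (of_real (c (Suc n)) * z ^ (n + 2)) :: complex) = (real n + 2) * T (Suc n) ?r"
        by (subst norm_mult, subst norm_term_Suc, subst norm_of_nat) simp
      show ?thesis using norm_near_sum(2)[OF times_f'_approx[OF lev]] unfolding * ** .
    qed
    also have "\<dots> \<le> norm (z * f' z) + (real n + 2) * (T n ?r / 4) + (real n + 1) / 4096 * (T n ?r + T n ?r / 4)"
      using 1 by (intro add_mono mult_left_mono) auto
    also have "\<dots> \<le> norm (z * f' z) + (real n + 1) * (3 / 4 * T n ?r)"
    proof -
      have "0 \<le> real n * T n ?r" using T0 by simp
      then show ?thesis using T0 by (simp add: field_simps)
    qed
    finally have "(real n + 1) * (T n ?r / 4) \<le> norm (z * f' z)" by (simp add: field_simps)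
    moreover have "1 * (T n ?r / 4) \<le> (real n + 1) * (T n ?r / 4)"
      using T0 by (intro mult_right_mono) auto
    ultimately show ?thesis by simp
  next
    case False
    have "T n ?r * (?r / a n) \<le> T n ?r * 2"
      using r a_pos[of n] by (intro mult_left_mono T0) (auto simp: field_simps)
    then have 1: "T (Suc n) ?r \<le> 2 * T n ?r" by (simp add: T_Suc)
    have "T n ?r \<ge> c n * (a n / 4) ^ (n + 1)"
      unfolding T_def using False a_pos[of n] c_pos[of n] by (intro mult_left_mono power_mono) auto
    \<comment> \<open>The factor 64 in the recursion pays off here: after the loss of
      \<open>4 ^ (n + 1)\<close> there remains \<open>16 ^ (n + 1)\<close>, enough to outweigh the
      factor \<open>n + 2\<close> in front of \<open>f z\<close>.\<close>
    also have "c n * (a n / 4) ^ (n + 1) = 16 ^ (n + 1) * a (Suc n)"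
    proof -
      have "c n * (a n / 4) ^ (n + 1) = c n * a n ^ (n + 1) / 4 ^ (n + 1)" by (simp add: power_divide)
      also have "\<dots> = (64 / 4) ^ (n + 1) * a (Suc n)" unfolding c_a by (simp only: power_divide) simp
      finally show ?thesis by simp
    qed
    finally have "16 ^ (n + 1) * a (Suc n) \<le> T n ?r" .
    moreover have "8 * (real n + 2) \<le> 16 ^ (n + 1)"
    proof (induction n)
      case (Suc n)
      then show ?case by simp
    qed simp
    then have "8 * (real n + 2) * a (Suc n) \<le> 16 ^ (n + 1) * a (Suc n)"
      using a_pos[of "Suc n"] by (intro mult_right_mono) auto
    ultimately have 2: "(real n + 2) * (2 * a (Suc n)) \<le> T n ?r / 4" by (simp add: algebra_simps)
    have "norm (of_nat (n + 2) * f z) = (real n + 2) * norm (f z)"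
      by (subst norm_mult, subst norm_of_nat) simp
    also have "\<dots> \<le> (real n + 2) * (2 * a (Suc n))" using fz by (intro mult_left_mono) auto
    finally have 3: "norm (of_nat (n + 2) * f z) \<le> T n ?r / 4" using 2 by simp
    have "T n ?r \<le> norm (z * f' z) + norm (of_nat (n + 2) * f z) + (T n ?r + T (Suc n) ?r) / 4096"
    proof -
      have "norm (z * f' z - (of_nat (n + 2) * f z + - (of_real (c n) * z ^ (n + 1))))
          \<le> (T n ?r + T (Suc n) ?r) / 4096"
        using times_f'_minus_f_approx[OF lev] by (simp only: diff_diff_eq[symmetric] diff_minus_eq_add)
      from norm_near_sum(3)[OF this] show ?thesis by (simp only: norm_minus_cancel norm_term)
    qed
    then show ?thesis using 1 3 T0 by argo
  qed
  then have "c n * ?r ^ n / 4 \<le> norm (f' z)"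
    using False by (simp add: T_def norm_mult)
  \<comment> \<open>The lower radius of the level is available for positive \<open>n\<close> only;
    for \<open>n = 0\<close> the exponent is 0.\<close>
  moreover have "c n * (a n / 2 ^ 15) ^ n / 4 \<le> c n * ?r ^ n / 4"
  proof (cases "n = 0")
    case False
    then have "a n / 2 ^ 15 \<le> ?r" using lev by (simp add: level_def)
    then show ?thesis using c_pos[of n] a_pos[of n] by (simp add: mult_left_mono power_mono)
  qed simp
  ultimately show ?thesis by simp
qed

section \<open>Expansion on small sets\<close>

lemma f_holomorphic: "f holomorphic_on S"
  unfolding holomorphic_on_def field_differentiable_def
  using f_has_field_derivative has_field_derivative_at_within by blast

text \<open>The coefficients are positive, so the value at the real point \<open>4 * a n\<close>
  bounds \<open>f\<close> on the whole disc. That point has level \<open>n\<close>, whatever the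
  level of \<open>z\<close>, and the two terms there have ratio 4, which gives
  \<open>2 * (1 + 4) = 10\<close>.\<close>

lemma norm_f_le_on_disc:
  assumes "norm z \<le> 4 * a n"
  shows "norm (f z) \<le> 10 * 4 ^ (n + 1) * (c n * a n ^ (n + 1))"
proof -
  let ?x = "of_real (4 * a n) :: complex"
  have nx: "norm ?x = 4 * a n" using a_pos[of n] by (simp add: norm_mult)
  have sm: "summable (\<lambda>k. c k * r ^ (k + 1))" for r :: real
    using summable_Re[OF f_summable[of "of_real r"]] by (simp flip: of_real_power of_real_mult)
  have norm_eq: "norm (of_real (c k) * w ^ (k + 1) :: complex) = c k * norm w ^ (k + 1)" for k w
    using norm_term[of k w] by (simp add: T_def)
  have "norm (f z) \<le> (\<Sum>k. norm (of_real (c k) * z ^ (k + 1) :: complex))"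
    unfolding f_def by (rule summable_norm) (subst norm_eq, rule sm)
  also have "\<dots> \<le> (\<Sum>k. c k * (4 * a n) ^ (k + 1))"
    unfolding norm_eq using assms c_pos by (intro suminf_le mult_left_mono power_mono sm) (auto simp: less_imp_le)
  also have "of_real \<dots> = f ?x"
    using suminf_of_real[OF sm, of "4 * a n", where ?'a = complex] by (simp add: f_def)
  then have "(\<Sum>k. c k * (4 * a n) ^ (k + 1)) \<le> norm (f ?x)"
    by (metis abs_ge_self norm_of_real)
  also have "\<dots> \<le> 2 * (T n (norm ?x) + T (Suc n) (norm ?x))"
  proof (rule norm_f_le)
    show "level n (norm ?x)" unfolding nx level_def
      using a_Suc_ge[of n] a_pos[of n] by simp
  qed
  also have "\<dots> = 10 * 4 ^ (n + 1) * (c n * a n ^ (n + 1))"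
    unfolding nx T_Suc using a_pos[of n] by (simp add: T_def power_mult_distrib)
  finally show ?thesis .
qed

text \<open>Cauchy's estimate on the ball of radius \<open>2 * a n\<close> about \<open>w\<close>,
  which lies in the disc of radius \<open>4 * a n\<close>. The constant 11 in place of 10 provides a
  strict bound.\<close>

lemma norm_deriv2_le:
  assumes w: "norm w \<le> 2 * a n"
  shows "norm (deriv f' w) \<le> 6 * 4 ^ (n + 1) * (c n * a n ^ (n + 1)) / a n ^ 2"
proof -
  define M where "M = c n * a n ^ (n + 1)"
  have M: "M > 0" using a_pos[of n] c_pos[of n] by (simp add: M_def)
  have "deriv f = f'" using f_has_field_derivative by (auto intro: DERIV_imp_deriv)
  then have "(deriv ^^ 2) f w = deriv f' w" by (simp add: numeral_2_eq_2)
  moreover have "norm ((deriv ^^ 2) f w) \<le> fact 2 * (11 * 4 ^ (n + 1) * M) / (2 * a n) ^ 2"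
  proof (rule Cauchy_higher_deriv_bound)
    fix u assume "u \<in> ball w (2 * a n)"
    then have "norm (u - w) < 2 * a n" by (simp add: dist_norm norm_minus_commute)
    then have "norm u \<le> 4 * a n" using w norm_triangle_sub[of u w] by simp
    then have "norm (f u) \<le> 10 * 4 ^ (n + 1) * M" unfolding M_def by (rule norm_f_le_on_disc)
    also have "\<dots> < 11 * 4 ^ (n + 1) * M" using M by simp
    finally show "f u \<in> ball 0 (11 * 4 ^ (n + 1) * M)" by simp
  qed (use a_pos[of n] f_holomorphic in \<open>auto intro: holomorphic_on_imp_continuous_on\<close>)
  moreover have "fact 2 * (11 * 4 ^ (n + 1) * M) / (2 * a n) ^ 2 \<le> 6 * 4 ^ (n + 1) * M / a n ^ 2"
    using M a_pos[of n] by (simp add: field_simps power2_eq_square)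
  ultimately show ?thesis by (simp add: M_def)
qed

lemma f'_has_field_derivative: "(f' has_field_derivative deriv f' z) (at z)"
proof -
  have "deriv f = f'" using f_has_field_derivative by (auto intro: DERIV_imp_deriv)
  then have "f' holomorphic_on UNIV" using holomorphic_deriv[OF f_holomorphic[of UNIV]] by simp
  then show ?thesis by (intro holomorphic_derivI[of _ UNIV]) auto
qed

text \<open>The deviation of \<open>f z - f w\<close> from \<open>f' w * (z - w)\<close> is at most
  \<open>D * norm (z - w) ^ 2\<close>, where \<open>D\<close> bounds the second derivative. For
  points this close it uses up at most half of the lower bound for \<open>f' w\<close>.\<close>

lemma f_expands:
  assumes w: "level n (norm w)" "norm w \<le> 2 * a n" "norm (f w) \<le> 2 * a (Suc n)"
    and z: "norm z \<le> 2 * a n" and zw: "norm (z - w) \<le> a n / 2 ^ (17 * (n + 1))"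
  shows "c n * (a n / 2 ^ 15) ^ n / 8 * norm (z - w) \<le> norm (f z - f w)"
proof -
  define D where "D = 6 * 4 ^ (n + 1) * (c n * a n ^ (n + 1)) / a n ^ 2"
  define S where "S = cball 0 (2 * a n) \<inter> cball w (norm (z - w))"
  have D0: "D \<ge> 0" using a_pos[of n] c_pos[of n] by (simp add: D_def)
  have S: "convex S" "w \<in> S" "z \<in> S"
    using w z a_pos[of n] by (auto simp: S_def convex_Int dist_norm norm_minus_commute)
  have f'_lip: "norm (f' u - f' w) \<le> D * norm (z - w)" if "u \<in> S" for u
  proof -
    have "norm (f' u - f' w) \<le> D * norm (u - w)"
    proof (rule field_differentiable_bound[OF S(1)])
      show "(f' has_field_derivative deriv f' x) (at x within S)" for x
        using f'_has_field_derivative has_field_derivative_at_within by blast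
      show "norm (deriv f' x) \<le> D" if "x \<in> S" for x
        using that norm_deriv2_le[of x n] by (simp add: D_def S_def)
    qed (use that S in auto)
    also have "\<dots> \<le> D * norm (z - w)"
      using that D0 by (intro mult_left_mono) (auto simp: S_def dist_norm norm_minus_commute)
    finally show ?thesis .
  qed
  \<comment> \<open>The mean value bound is applied to \<open>f\<close> minus its linear part at
    \<open>w\<close>, whose derivative is small on \<open>S\<close>.\<close>
  have "norm ((f z - f' w * z) - (f w - f' w * w)) \<le> D * norm (z - w) * norm (z - w)"
  proof (rule field_differentiable_bound[OF S(1), where f' = "\<lambda>u. f' u - f' w"])
    show "((\<lambda>u. f u - f' w * u) has_field_derivative f' x - f' w) (at x within S)" for x
      by (auto intro!: derivative_eq_intros has_field_derivative_at_within[OF f_has_field_derivative])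
  qed (use f'_lip S in auto)
  also have "(f z - f' w * z) - (f w - f' w * w) = (f z - f w) - f' w * (z - w)" by (simp add: algebra_simps)
  finally have 1: "norm ((f z - f w) - f' w * (z - w)) \<le> D * norm (z - w) * norm (z - w)" .
  have "D * norm (z - w) \<le> D * (a n / 2 ^ (17 * (n + 1)))" using zw D0 by (rule mult_left_mono)
  also have "\<dots> \<le> c n * (a n / 2 ^ 15) ^ n / 8"
  proof -
    \<comment> \<open>Of the exponent 17, a share of 15 matches the factor
      \<open>(2 ^ 15) ^ n\<close> of the lower bound and 2 compensates \<open>4 ^ n\<close>. The
      spare \<open>2 ^ 17\<close> due to \<open>n + 1\<close> absorbs the constants.\<close>
    define P where "P = (2::real) ^ n"
    have P: "P \<ge> 1" by (simp add: P_def)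
    have pw: "(2::real) ^ (k * n) = P ^ k" for k by (simp add: P_def power_mult[symmetric] mult.commute)
    have p4: "(4::real) ^ n = P ^ 2" by (simp add: P_def power2_eq_square flip: power_mult_distrib)
    have "D * (a n / 2 ^ (17 * (n + 1))) = (c n * a n ^ n) * (24 * P ^ 2 / (2 ^ 17 * P ^ 17))"
      using a_pos[of n] pw[of 17] p4
      by (simp add: D_def power_add power2_eq_square field_simps)
    also have "\<dots> \<le> (c n * a n ^ n) * (1 / (8 * P ^ 15))"
      using a_pos[of n] c_pos[of n] P by (intro mult_left_mono) (auto simp: field_simps simp flip: power_add)
    also have "\<dots> = c n * (a n / 2 ^ 15) ^ n / 8"
      using pw[of 15] by (simp add: power_divide power_mult)
    finally show ?thesis .
  qed
  finally have "D * norm (z - w) * norm (z - w) \<le> c n * (a n / 2 ^ 15) ^ n / 8 * norm (z - w)"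
    by (rule mult_right_mono) simp
  with 1 have 2: "norm ((f z - f w) - f' w * (z - w)) \<le> c n * (a n / 2 ^ 15) ^ n / 8 * norm (z - w)"
    by simp
  have "c n * (a n / 2 ^ 15) ^ n / 4 * norm (z - w) \<le> norm (f' w) * norm (z - w)"
    using norm_f'_ge[OF w] by (rule mult_right_mono) simp
  then have "c n * (a n / 2 ^ 15) ^ n / 4 * norm (z - w) \<le> norm (f' w * (z - w))" by (simp add: norm_mult)
  also have "\<dots> \<le> norm (f z - f w) + norm ((f z - f w) - f' w * (z - w))" by norm
  finally show ?thesis using 2 by simp
qed

text \<open>By \<open>c_a\<close> the expansion factor is
  \<open>64 ^ (n + 1) * y n / (8 * (2 ^ 15) ^ n)\<close>, and \<open>y n\<close> contains
  \<open>W ^ (n + 1)\<close>.\<close>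

lemma expansion_factor_ge: "(W / 2 ^ 15) ^ (n + 1) \<le> c n * (a n / 2 ^ 15) ^ n / 8"
proof -
  have W0: "W \<ge> 0" using W by simp
  have "c n * (a n / 2 ^ 15) ^ n / 8 = (c n * a n ^ (n + 1)) / (8 * a n * (2 ^ 15) ^ n)"
    using a_pos[of n] by (simp add: power_divide)
  also have "\<dots> = 64 ^ (n + 1) * y n / (8 * (2 ^ 15) ^ n)"
    unfolding c_a using a_pos[of n] by (simp add: a.simps)
  also have "\<dots> \<ge> 1 * (64 * W ^ (n + 1)) / (8 * (2 ^ 15) ^ n)"
    using y_ge[of n] W0 by (intro divide_right_mono mult_mono one_le_power) auto
  also have "1 * (64 * W ^ (n + 1)) / (8 * (2 ^ 15) ^ n) = (W / 2 ^ 15) ^ (n + 1) * 2 ^ 18"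
    by (simp add: power_divide)
  also have "\<dots> \<ge> (W / 2 ^ 15) ^ (n + 1)" using W0 by (simp add: mult_le_cancel_left1)
  finally show ?thesis .
qed

section \<open>Transcendence\<close>

lemma f_not_polynomial: "f \<noteq> poly p"
proof
  assume fp: "f = poly p"
  define d :: "nat \<Rightarrow> complex" where "d n = (case n of 0 \<Rightarrow> 0 | Suc k \<Rightarrow> of_real (c k))" for n
  have "(\<lambda>n. (d n - coeff p n) * (w - 0) ^ n) sums 0" for w
  proof -
    have "(\<lambda>k. d (Suc k) * w ^ Suc k) sums (f w)"
      using summable_sums[OF f_summable[of w]] by (simp add: f_def d_def)
    then have "(\<lambda>k. d k * w ^ k) sums (f w)" by (subst (asm) sums_Suc_iff) (simp add: d_def)
    moreover have "(\<lambda>k. coeff p k * w ^ k) sums poly p w"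
      unfolding poly_altdef by (rule sums_finite) (auto simp: coeff_eq_0)
    ultimately have "(\<lambda>k. d k * w ^ k - coeff p k * w ^ k) sums (f w - poly p w)"
      by (rule sums_diff)
    then show ?thesis by (simp add: fp algebra_simps)
  qed
  moreover have "d (Suc (degree p)) - coeff p (Suc (degree p)) \<noteq> 0"
    using c_pos[of "degree p"] by (simp add: d_def coeff_eq_0)
  \<comment> \<open>A power series with a nonzero coefficient has no zeros in some punctured disc
    about 0, yet this one sums to 0 everywhere.\<close>
  ultimately obtain s where s: "0 < s" "\<And>z::complex. z \<in> cball 0 s - {0} \<Longrightarrow> (0::complex) \<noteq> 0"
    using powser_0_nonzero[of 1 0 "\<lambda>n. d n - coeff p n" "\<lambda>_. 0" "Suc (degree p)"] by auto
  show False using s(2)[of "of_real s"] s(1) by simp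
qed

lemma transcendental_entire_f: "transcendental_entire f"
  using f_holomorphic f_not_polynomial by (auto simp: transcendental_entire_def)

section \<open>Points with bounded orbit\<close>

lemma f_bounded_orbit_set: "z \<in> bounded_orbit_set f \<Longrightarrow> f z \<in> bounded_orbit_set f"
proof -
  assume "z \<in> bounded_orbit_set f"
  moreover have "range (\<lambda>n. (f ^^ n) (f z)) \<subseteq> range (\<lambda>n. (f ^^ n) z)"
  proof (intro image_subsetI)
    fix n
    have "(f ^^ n) (f z) = (f ^^ Suc n) z" by (simp only: funpow_Suc_right comp_apply)
    then show "(f ^^ n) (f z) \<in> range (\<lambda>n. (f ^^ n) z)" by (metis rangeI)
  qed
  ultimately show ?thesis by (auto simp: bounded_orbit_set_def intro: bounded_subset)
qed

text \<open>Otherwise each iteration would lead into the next such annulus, and the moduli would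
  exceed \<open>2 * a (n + k)\<close>, which is unbounded in \<open>k\<close>.\<close>

lemma bounded_orbit_not_between_levels:
  assumes "z \<in> bounded_orbit_set f"
  shows "\<not> (2 * a n < norm z \<and> norm z < a (Suc n) / 2 ^ 15)"
proof
  assume *: "2 * a n < norm z \<and> norm z < a (Suc n) / 2 ^ 15"
  have escape: "2 * a (n + k) < norm ((f ^^ k) z) \<and> norm ((f ^^ k) z) < a (Suc (n + k)) / 2 ^ 15" for k
    by (induction k) (use * escape_step in auto)
  obtain B where B: "\<And>k. norm ((f ^^ k) z) \<le> B"
    using assms by (auto simp: bounded_orbit_set_def bounded_iff)
  obtain k :: nat where k: "B \<le> real k" using real_arch_simple by blast
  have "real k < 2 ^ k" by (rule of_nat_less_two_power)
  also have "\<dots> \<le> a k" by (rule a_ge)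
  also have "\<dots> \<le> a (n + k)" by (rule a_mono) simp
  finally show False using escape[of k] B[of k] k a_pos[of "n + k"] by linarith
qed

lemma bounded_orbit_level:
  assumes z: "z \<in> bounded_orbit_set f"
  obtains n where "level n (norm z)" "norm z \<le> 2 * a n" "norm (f z) \<le> 2 * a (Suc n)"
proof -
  obtain m where m: "level m (norm z)" using ex_level[of "norm z"] by auto
  have "\<exists>n. level n (norm z) \<and> norm z \<le> 2 * a n"
  proof (cases "norm z \<le> 2 * a m")
    \<comment> \<open>Only the outer boundary circle of level \<open>m\<close> is left, and it also
      belongs to level \<open>m + 1\<close>.\<close>
    case False
    then have eq: "norm z = a (Suc m) / 2 ^ 15"
      using bounded_orbit_not_between_levels[OF z, of m] m by (auto simp: level_def)
    have "level (Suc m) (norm z)"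
      using a_mono[of "Suc m" "Suc (Suc m)"] a_pos[of "Suc m"] by (simp add: eq level_def)
    moreover have "norm z \<le> 2 * a (Suc m)" using a_pos[of "Suc m"] by (simp add: eq)
    ultimately show ?thesis by blast
  qed (use m in auto)
  then obtain n where n: "level n (norm z)" "norm z \<le> 2 * a n" by blast
  moreover have "norm (f z) \<le> 2 * a (Suc n)"
    using bounded_orbit_not_between_levels[OF f_bounded_orbit_set[OF z], of "Suc n"] norm_f_less[OF n(1)] by auto
  ultimately show thesis by (rule that)
qed

section \<open>Covering each level by small squares\<close>

text \<open>The exponent 18 leaves room for the diameter of a square, at most
  \<open>2 * mesh n\<close>, to stay below the distance \<open>a n / 2 ^ (17 * (n + 1))\<close> on
  which expansion is known.\<close>

definition mesh :: "nat \<Rightarrow> real" where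
  "mesh n = a n / 2 ^ (18 * (n + 1))"

definition piece :: "nat \<times> int \<times> int \<Rightarrow> complex set" where
  "piece = (\<lambda>(n, i, j). {z. level n (norm z) \<and> norm z \<le> 2 * a n \<and> norm (f z) \<le> 2 * a (Suc n) \<and>
     \<lfloor>Re z / mesh n\<rfloor> = i \<and> \<lfloor>Im z / mesh n\<rfloor> = j})"

text \<open>Index range of the squares that meet the disc of radius \<open>2 * a n\<close>, as
  \<open>2 * a n / mesh n = 2 * 2 ^ (18 * (n + 1))\<close>.\<close>

definition cells :: "nat \<Rightarrow> (int \<times> int) set" where
  "cells n = {- 2 * 2 ^ (18 * (n + 1))..2 * 2 ^ (18 * (n + 1))} \<times> {- 2 * 2 ^ (18 * (n + 1))..2 * 2 ^ (18 * (n + 1))}"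

lemma mesh_pos: "0 < mesh n"
  using a_pos by (simp add: mesh_def)

lemma finite_cells: "finite (cells n)"
  by (simp add: cells_def)

lemma card_cells_le: "real (card (cells n)) \<le> (2 ^ 42) ^ (n + 1)"
proof -
  define q where "q = (2::real) ^ (18 * (n + 1))"
  have q: "q \<ge> 1" by (simp add: q_def)
  have "real (card (cells n)) = (4 * q + 1) * (4 * q + 1)"
    by (simp add: cells_def card_cartesian_product q_def nat_add_distrib nat_mult_distrib nat_power_eq algebra_simps)
  also have "\<dots> \<le> (8 * q) * (8 * q)" using q by (intro mult_mono) auto
  also have "\<dots> = 2 ^ 6 * 2 ^ (36 * (n + 1))" by (simp add: q_def flip: power_add)
  also have "\<dots> \<le> 2 ^ (6 * (n + 1)) * 2 ^ (36 * (n + 1))"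
    by (intro mult_right_mono power_increasing) auto
  also have "\<dots> = 2 ^ (42 * (n + 1))" by (simp flip: power_add)
  finally show ?thesis by (simp only: power_mult)
qed

lemma abs_diff_le_mesh:
  assumes "\<lfloor>u / mesh n\<rfloor> = \<lfloor>v / mesh n\<rfloor>"
  shows "\<bar>u - v\<bar> \<le> mesh n"
proof -
  have "\<bar>u / mesh n - v / mesh n\<bar> \<le> 1"
    using assms floor_correct[of "u / mesh n"] floor_correct[of "v / mesh n"] by linarith
  then have "\<bar>(u - v) / mesh n\<bar> \<le> 1" by (simp add: diff_divide_distrib)
  then show ?thesis using mesh_pos[of n] by (simp add: abs_divide field_simps)
qed

lemma piece_expands:
  assumes "z \<in> piece (n, i, j)" "w \<in> piece (n, i, j)"
  shows "(W / 2 ^ 15) ^ (n + 1) * dist z w \<le> dist (f z) (f w)"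
proof -
  have "norm (z - w) \<le> \<bar>Re z - Re w\<bar> + \<bar>Im z - Im w\<bar>" using cmod_le[of "z - w"] by simp
  also have "\<dots> \<le> mesh n + mesh n"
    using assms by (intro add_mono abs_diff_le_mesh) (auto simp: piece_def)
  also have "\<dots> = a n * 2 / 2 ^ (17 * (n + 1) + (n + 1))"
  proof -
    have "18 * (n + 1) = 17 * (n + 1) + (n + 1)" by simp
    then show ?thesis unfolding mesh_def by (simp only: mult_2_right add_divide_distrib)
  qed
  also have "\<dots> = (a n / 2 ^ (17 * (n + 1))) * (1 / 2 ^ n)" by (simp only: power_add) simp
  also have "\<dots> \<le> (a n / 2 ^ (17 * (n + 1))) * 1" using a_pos[of n] by (intro mult_left_mono) auto
  finally have near: "norm (z - w) \<le> a n / 2 ^ (17 * (n + 1))" by simp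
  have "(W / 2 ^ 15) ^ (n + 1) * norm (z - w) \<le> c n * (a n / 2 ^ 15) ^ n / 8 * norm (z - w)"
    by (intro mult_right_mono expansion_factor_ge) auto
  also have "\<dots> \<le> norm (f z - f w)"
    using assms near by (intro f_expands) (auto simp: piece_def)
  finally show ?thesis by (simp add: dist_norm)
qed

lemma floor_in_cells:
  assumes "\<bar>x\<bar> \<le> 2 * a n"
  shows "- 2 * 2 ^ (18 * (n + 1)) \<le> \<lfloor>x / mesh n\<rfloor>" "\<lfloor>x / mesh n\<rfloor> \<le> 2 * 2 ^ (18 * (n + 1))"
proof -
  define q where "q = (2::int) ^ (18 * (n + 1))"
  have q: "real_of_int q * mesh n = a n" by (simp add: q_def mesh_def)
  have "- (2 * real_of_int q) \<le> x / mesh n" "x / mesh n \<le> 2 * real_of_int q"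
    using assms mesh_pos[of n] q by (auto simp: field_simps abs_le_iff)
  then have "of_int (- 2 * q) \<le> x / mesh n" "x / mesh n \<le> of_int (2 * q)" by simp_all
  then have "- 2 * q \<le> \<lfloor>x / mesh n\<rfloor>" "\<lfloor>x / mesh n\<rfloor> \<le> 2 * q"
    by (auto simp only: le_floor_iff intro: order_trans[OF floor_mono]) (metis floor_mono floor_of_int)
  then show "- 2 * 2 ^ (18 * (n + 1)) \<le> \<lfloor>x / mesh n\<rfloor>" "\<lfloor>x / mesh n\<rfloor> \<le> 2 * 2 ^ (18 * (n + 1))"
    by (simp_all only: q_def)
qed

section \<open>Packing measure of the set of bounded orbits\<close>

lemma packing_measure_bounded_orbit_set:
  assumes s: "0 < s" and st: "s < t" and large: "3 * 2 ^ 42 \<le> (W / 2 ^ 15) powr s"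
  shows "packing_measure t (bounded_orbit_set f) = 0"
proof -
  \<comment> \<open>Sorting by a bound for the whole orbit gives countably many forward invariant
    bounded sets, each meeting finitely many levels.\<close>
  define X where "X R = {z \<in> bounded_orbit_set f. \<forall>k. norm ((f ^^ k) z) \<le> real R}" for R
  have "packing_premeasure t (X R) = 0" for R
  proof -
    define V where "V = W / 2 ^ 15"
    have V: "V \<ge> 2" using W by (simp add: V_def)
    have Vs: "V powr - s \<le> 1 / (3 * 2 ^ 42)"
      using large V by (simp add: V_def powr_minus field_simps)
    \<comment> \<open>For \<open>n > m\<close> the inner radius \<open>a n / 2 ^ 15\<close> exceeds
      \<open>R\<close>, so the levels up to \<open>m\<close> suffice.\<close>
    obtain m :: nat where m: "real R * 2 ^ 15 \<le> real m" using real_arch_simple by blast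
    define I where "I = (SIGMA n:{..m}. cells n)"
    define l where "l = (\<lambda>(n::nat, p::int \<times> int). V ^ (n + 1))"
    have fin: "finite I" by (simp add: I_def finite_cells)
    have inv: "f ` X R \<subseteq> X R"
    proof (intro image_subsetI)
      fix z assume z: "z \<in> X R"
      have "norm ((f ^^ k) (f z)) \<le> real R" for k
      proof -
        have "(f ^^ k) (f z) = (f ^^ Suc k) z" by (simp only: funpow_Suc_right comp_apply)
        then show ?thesis using z unfolding X_def by (metis (mono_tags, lifting) mem_Collect_eq)
      qed
      then show "f z \<in> X R" using z by (simp add: X_def f_bounded_orbit_set)
    qed
    have normX: "norm z \<le> real R" if "z \<in> X R" for z
      using that unfolding X_def by (auto dest: spec[of _ 0])
    have cov: "X R \<subseteq> (\<Union>p\<in>I. piece p)"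
    proof
      fix z assume z: "z \<in> X R"
      obtain n where n: "level n (norm z)" "norm z \<le> 2 * a n" "norm (f z) \<le> 2 * a (Suc n)"
        using bounded_orbit_level z unfolding X_def by blast
      have "n \<le> m"
      proof (cases n)
        case (Suc k)
        have "real n < 2 ^ n" by (rule of_nat_less_two_power)
        also have "\<dots> \<le> a n" by (rule a_ge)
        also have "\<dots> \<le> norm z * 2 ^ 15" using n(1) Suc by (simp add: level_def field_simps)
        also have "\<dots> \<le> real m" using normX[OF z] m by simp
        finally show ?thesis by simp
      qed simp
      moreover have "(\<lfloor>Re z / mesh n\<rfloor>, \<lfloor>Im z / mesh n\<rfloor>) \<in> cells n"
        using floor_in_cells[of "Re z" n] floor_in_cells[of "Im z" n] n(2)
          abs_Re_le_cmod[of z] abs_Im_le_cmod[of z]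
        unfolding cells_def mem_Sigma_iff atLeastAtMost_iff by linarith
      ultimately have "(n, \<lfloor>Re z / mesh n\<rfloor>, \<lfloor>Im z / mesh n\<rfloor>) \<in> I" by (simp add: I_def)
      moreover have "z \<in> piece (n, \<lfloor>Re z / mesh n\<rfloor>, \<lfloor>Im z / mesh n\<rfloor>)" using n by (simp add: piece_def)
      ultimately show "z \<in> (\<Union>p\<in>I. piece p)" by blast
    qed
    have l2: "l p \<ge> 2" for p
    proof -
      have "V \<le> V ^ (fst p + 1)" using V by (intro self_le_power) auto
      with V have "2 \<le> V ^ (fst p + 1)" by (rule order_trans)
      then show ?thesis by (simp only: l_def split_def)
    qed
    have exp: "l p * dist x y \<le> dist (f x) (f y)" if "x \<in> X R \<inter> piece p" "y \<in> X R \<inter> piece p" for p x y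
      using that piece_expands[of x "fst p" "fst (snd p)" "snd (snd p)" y] by (simp add: l_def V_def split_def)
    have "(\<Sum>p\<in>I. l p powr - s) = (\<Sum>n\<le>m. \<Sum>p\<in>cells n. (V ^ (n + 1)) powr - s)"
      unfolding I_def by (subst sum.Sigma) (auto simp: l_def finite_cells split_def)
    also have "\<dots> \<le> (\<Sum>n\<le>m. (1 / 3) ^ (n + 1))"
    proof (rule sum_mono)
      fix n
      have "(V ^ (n + 1)) powr - s = (V powr real (n + 1)) powr - s"
        using V by (subst powr_realpow) auto
      also have "\<dots> = (V powr - s) powr real (n + 1)" by (simp only: powr_powr mult.commute)
      also have "\<dots> = (V powr - s) ^ (n + 1)" using V by (subst powr_realpow) auto
      finally have "(\<Sum>p\<in>cells n. (V ^ (n + 1)) powr - s) = real (card (cells n)) * (V powr - s) ^ (n + 1)"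
        by simp
      \<comment> \<open>The hypothesis on \<open>W\<close> is tailored to this step: the contraction
        outweighs the number of squares by \<open>3 ^ (n + 1)\<close>, and the geometric series over
        all levels has sum \<open>1 / 2\<close>.\<close>
      also have "\<dots> \<le> (2 ^ 42) ^ (n + 1) * (1 / (3 * 2 ^ 42)) ^ (n + 1)"
        using Vs by (intro mult_mono card_cells_le power_mono) auto
      also have "\<dots> = (1 / 3) ^ (n + 1)" by (simp flip: power_mult_distrib)
      finally show "(\<Sum>p\<in>cells n. (V ^ (n + 1)) powr - s) \<le> (1 / 3) ^ (n + 1)" .
    qed
    also have "\<dots> = 1 / 3 * (\<Sum>n\<le>m. (1 / 3) ^ n)" by (simp add: sum_distrib_left)
    also have "\<dots> \<le> 1 / 3 * (\<Sum>n. (1 / 3) ^ n)"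
      by (intro mult_left_mono sum_le_suminf summable_geometric) auto
    also have "\<dots> = 1 / 2" by (simp add: suminf_geometric)
    finally have sum: "(\<Sum>p\<in>I. l p powr - s) \<le> 1 / 2" .
    obtain F :: "complex set" where F: "finite F" "cball 0 (real R) \<subseteq> (\<Union>k\<in>F. ball k 1)"
      using compact_cball[of "0::complex" "real R"] unfolding compact_eq_totally_bounded
      by (meson zero_less_one)
    then have "X R \<subseteq> (\<Union>k\<in>F. ball k 1)" using normX by force
    from packing_sum_bounded_if_expanding[OF fin inv cov exp l2 s sum F(1) this]
    show ?thesis using packing_premeasure_eq_0[OF _ _ st] by metis
  qed
  moreover have "bounded_orbit_set f \<subseteq> (\<Union>R. X R)"
  proof
    fix z assume z: "z \<in> bounded_orbit_set f"
    then obtain B where B: "\<And>k. norm ((f ^^ k) z) \<le> B"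
      by (auto simp: bounded_orbit_set_def bounded_iff)
    obtain R :: nat where "B \<le> real R" using real_arch_simple by blast
    then have "z \<in> X R" using z B by (auto simp: X_def intro: order_trans)
    then show "z \<in> (\<Union>R. X R)" by blast
  qed
  ultimately show ?thesis by (intro packing_measure_eq_0)
qed

end

theorem theorem2:
  fixes \<epsilon> :: real
  assumes "\<epsilon> > 0"
  shows "\<exists>f. transcendental_entire f \<and>
    hausdorff_dim (bounded_orbit_set f) \<le> packing_dim (bounded_orbit_set f) \<and>
    packing_dim (bounded_orbit_set f) < ennreal \<epsilon>"
proof -
  \<comment> \<open>The packing sums are bounded for \<open>s\<close>, the packing measure vanishes
    for the larger exponent \<open>\<epsilon> / 2\<close>, and this is still below
    \<open>\<epsilon>\<close>.\<close>
  define s where "s = \<epsilon> / 3"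
  \<comment> \<open>The first argument of the maximum gives \<open>2 ^ 15 * V \<ge> 2 ^ 30\<close>,
    the second \<open>V powr s \<ge> 3 * 2 ^ 42\<close>.\<close>
  define V where "V = max (2 ^ 15) ((3 * 2 ^ 42) powr (1 / s))"
  have s: "0 < s" using assms by (simp add: s_def)
  interpret lacunary_series "2 ^ 15 * V"
    by unfold_locales (simp add: V_def)
  have "3 * 2 ^ 42 = ((3 * 2 ^ 42) powr (1 / s)) powr s" using s by (simp add: powr_powr)
  also have "\<dots> \<le> V powr s" using s by (intro powr_mono2) (auto simp: V_def)
  finally have "packing_measure (\<epsilon> / 2) (bounded_orbit_set f) = 0"
    using s assms by (intro packing_measure_bounded_orbit_set[of s]) (auto simp: s_def)
  then have "packing_dim (bounded_orbit_set f) \<le> ennreal (\<epsilon> / 2)"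
    unfolding packing_dim_def using assms by (intro Inf_lower) auto
  also have "\<dots> < ennreal \<epsilon>" using assms by (intro ennreal_lessI) auto
  finally show ?thesis using transcendental_entire_f hausdorff_dim_le_packing_dim by blast
qed

end
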